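(* The problem Terminal Monitoring Set (defined in the context) admits an FPT algorithm when parameterized by $k + t$, where $k$ is the solution-size bound of the instance and $t$ is the neighborhood diversity of the input graph $G$; i.e., it can be decided in time $f(k+t)\cdot |I|^{O(1)}$ for some computable function $f$, where $|I|$ is the instance size.
   Context: Terminal Monitoring Set (TMS): the input is $(G,\mathcal{T},k)$ where $G=(V,E)$ is a finite simple undirected graph, $\mathcal{T}$ is a collection of pairs $\{u,v\}$ of vertices of $G$ (terminal pairs), and $k\in\mathbb{N}$. The question is whether there is $S\subseteq V$ with $|S|\le k$ such that for every $\{u,v\}\in\mathcal{T}$ there is $w\in S$ with $d(u,w)+d(w,v)=d(u,v)$, where $d$ is shortest-path distance in $G$. It is assumed that every terminal pair is at finite distance. Two vertices $u,v$ have the same type if $N(u)\setminus\{v\}=N(v)\setminus\{u\}$; $G$ has neighborhood diversity at most $t$ if $V$ can be partitioned into at most $t$ sets each consisting of vertices of the same type. *)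

theory Defs
  imports
    "Graph_Theory.Graph_Theory"
    "HOL-Library.Log_Nat"
    "HOL-Library.Disjoint_Sets"
begin

section \<open>Graphs, distance and neighborhood diversity\<close>

text \<open>
  A finite simple undirected graph is a \<^locale>\<open>pair_graph\<close>: a finite vertex set with a
  finite, symmetric, loop-free set of arcs, an edge being represented by its two orientations.
  Distances are the weighted shortest-path values of the library for unit weights; they are
  extended reals, with value infinity between different components.
\<close>

definition gdist :: "'a pair_pre_digraph \<Rightarrow> 'a \<Rightarrow> 'a \<Rightarrow> ereal" where
  "gdist G u v = wf_digraph.\<mu> (with_proj G) (\<lambda>_. 1) u v"

definition nbhd :: "'a pair_pre_digraph \<Rightarrow> 'a \<Rightarrow> 'a set" where
  "nbhd G u = {w. (u, w) \<in> parcs G}"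

definition same_type :: "'a pair_pre_digraph \<Rightarrow> 'a \<Rightarrow> 'a \<Rightarrow> bool" where
  "same_type G u v \<longleftrightarrow> nbhd G u - {v} = nbhd G v - {u}"

definition nd_at_most :: "'a pair_pre_digraph \<Rightarrow> nat \<Rightarrow> bool" where
  "nd_at_most G t \<longleftrightarrow>
     (\<exists>P. partition_on (pverts G) P \<and> card P \<le> t \<and>
          (\<forall>A\<in>P. \<forall>u\<in>A. \<forall>v\<in>A. same_type G u v))"

definition neighborhood_diversity :: "'a pair_pre_digraph \<Rightarrow> nat" where
  "neighborhood_diversity G = (LEAST t. nd_at_most G t)"

lemma nd_at_most_neighborhood_diversity: "nd_at_most G (neighborhood_diversity G)"
proof -
  have "partition_on (pverts G) ((\<lambda>v. {v}) ` pverts G)"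
    by (auto simp: partition_on_def disjoint_def)
  then have "nd_at_most G (card ((\<lambda>v. {v}) ` pverts G))"
    unfolding nd_at_most_def by (intro exI[of _ "(\<lambda>v. {v}) ` pverts G"]) (auto simp: same_type_def)
  then show ?thesis
    unfolding neighborhood_diversity_def by (rule LeastI)
qed


section \<open>Terminal Monitoring Set\<close>

record 'a tms =
  tms_graph :: "'a pair_pre_digraph"
  tms_pairs :: "'a set set"
  tms_bound :: nat

definition tms_wf :: "'a tms \<Rightarrow> bool" where
  "tms_wf I \<longleftrightarrow>
     pair_graph (tms_graph I) \<and>
     (\<forall>p\<in>tms_pairs I. \<exists>u\<in>pverts (tms_graph I). \<exists>v\<in>pverts (tms_graph I). p = {u, v}) \<and>
     (\<forall>u v. {u, v} \<in> tms_pairs I \<longrightarrow> gdist (tms_graph I) u v < \<infinity>)"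

definition tms_yes :: "'a tms \<Rightarrow> bool" where
  "tms_yes I \<longleftrightarrow>
     (\<exists>S \<subseteq> pverts (tms_graph I). card S \<le> tms_bound I \<and>
        (\<forall>u v. {u, v} \<in> tms_pairs I \<longrightarrow>
           (\<exists>w\<in>S. gdist (tms_graph I) u w + gdist (tms_graph I) w v = gdist (tms_graph I) u v)))"


section \<open>Random access machines\<close>

text \<open>
  The machine model is the random access machine, programmed with structured control flow.
  There is a read-only input of finitely many words and a memory of cells holding natural
  numbers, both with indirect addressing; initially all cells are 0. Addition and truncated
  subtraction are the only arithmetic operations, so that unit cost is polynomially equivalent
  to the time of a Turing machine on the bit representation of the input. Each assignment, each
  skip and each evaluation of a guard takes one step: the expressions occurring in a program
  have a size that does not depend on its input.
\<close>

datatype exp =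
    Const nat
  | InputLength
  | Input exp
  | Mem exp
  | Add exp exp
  | Sub exp exp

datatype com =
    Skip
  | Store exp exp
  | Seq com com
  | If exp com com
  | While exp com

type_synonym memory = "nat \<Rightarrow> nat"

fun val :: "nat list \<Rightarrow> memory \<Rightarrow> exp \<Rightarrow> nat" where
  "val xs m (Const n) = n"
| "val xs m InputLength = length xs"
| "val xs m (Input e) = (if val xs m e < length xs then xs ! val xs m e else 0)"
| "val xs m (Mem e) = m (val xs m e)"
| "val xs m (Add e e') = val xs m e + val xs m e'"
| "val xs m (Sub e e') = val xs m e - val xs m e'"

text \<open>
  \<open>exec xs c m t m'\<close>: on input \<open>xs\<close>, the program \<open>c\<close> started in memory \<open>m\<close> halts in
  memory \<open>m'\<close> after exactly \<open>t\<close> steps.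
\<close>

inductive exec :: "nat list \<Rightarrow> com \<Rightarrow> memory \<Rightarrow> nat \<Rightarrow> memory \<Rightarrow> bool" for xs where
  Skip: "exec xs Skip m 1 m"
| Store: "exec xs (Store a e) m 1 (m(val xs m a := val xs m e))"
| Seq: "exec xs c m t m' \<Longrightarrow> exec xs c' m' t' m'' \<Longrightarrow> exec xs (Seq c c') m (t + t') m''"
| IfTrue: "val xs m b \<noteq> 0 \<Longrightarrow> exec xs c m t m' \<Longrightarrow> exec xs (If b c c') m (1 + t) m'"
| IfFalse: "val xs m b = 0 \<Longrightarrow> exec xs c' m t m' \<Longrightarrow> exec xs (If b c c') m (1 + t) m'"
| WhileTrue: "val xs m b \<noteq> 0 \<Longrightarrow> exec xs c m t m' \<Longrightarrow> exec xs (While b c) m' t' m'' \<Longrightarrow>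
    exec xs (While b c) m (1 + t + t') m''"
| WhileFalse: "val xs m b = 0 \<Longrightarrow> exec xs (While b c) m 1 m"

inductive_cases exec_SkipE: "exec xs Skip m t m'"
inductive_cases exec_StoreE: "exec xs (Store a e) m t m'"
inductive_cases exec_SeqE: "exec xs (Seq c c') m t m'"
inductive_cases exec_IfE: "exec xs (If b c c') m t m'"

lemma exec_deterministic:
  "exec xs c m t m' \<Longrightarrow> exec xs c m u m'' \<Longrightarrow> t = u \<and> m' = m''"
proof (induction arbitrary: u m'' rule: exec.induct)
  case (Skip m)
  then show ?case by (auto elim: exec_SkipE)
next
  case (Store m a e)
  then show ?case by (auto elim: exec_StoreE)
next
  case (Seq c m t m1 c' t' m2)
  from Seq.prems obtain v v' m3
    where "exec xs c m v m3" "exec xs c' m3 v' m''" "u = v + v'"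
    by (rule exec_SeqE)
  with Seq.IH show ?case by metis
next
  case (IfTrue m b c t m1 c')
  from IfTrue.prems IfTrue.hyps obtain v where "exec xs c m v m''" "u = 1 + v"
    by (auto elim: exec_IfE)
  with IfTrue.IH show ?case by metis
next
  case (IfFalse m b c' t m1 c)
  from IfFalse.prems IfFalse.hyps obtain v where "exec xs c' m v m''" "u = 1 + v"
    by (auto elim: exec_IfE)
  with IfFalse.IH show ?case by metis
next
  case (WhileTrue m b c t m1 t' m2)
  from WhileTrue.prems WhileTrue.hyps obtain v m3 v'
    where "exec xs c m v m3" "exec xs (While b c) m3 v' m''" "u = 1 + v + v'"
    by (cases rule: exec.cases) auto
  with WhileTrue.IH show ?case by metis
next
  case (WhileFalse m b c)
  from WhileFalse.prems WhileFalse.hyps show ?case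
    by (cases rule: exec.cases) auto
qed

text \<open>
  \<open>halts_with c xs t y\<close>: on input \<open>xs\<close>, the program \<open>c\<close> halts after exactly \<open>t\<close> steps with
  output \<open>y\<close>, which is read off from cell 0.
\<close>

definition halts_with :: "com \<Rightarrow> nat list \<Rightarrow> nat \<Rightarrow> nat \<Rightarrow> bool" where
  "halts_with c xs t y \<longleftrightarrow> (\<exists>m. exec xs c (\<lambda>_. 0) t m \<and> m 0 = y)"

definition computable :: "(nat \<Rightarrow> nat) \<Rightarrow> bool" where
  "computable f \<longleftrightarrow> (\<exists>c. \<forall>n. \<exists>t. halts_with c [n] t (f n))"


section \<open>Fixed-parameter tractability\<close>

definition bit_size :: "nat list \<Rightarrow> nat" where
  "bit_size xs = (\<Sum>x\<leftarrow>xs. max 1 (floorlog 2 x))"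

text \<open>
  A parameterized problem is given by its set of instances, its set of yes-instances, an
  encoding of the instances as inputs of the machine, and a parameter. One program has to
  decide all instances; its running time is not required to be bounded on inputs
  that do not encode an instance.
\<close>

definition fpt :: "'i set \<Rightarrow> 'i set \<Rightarrow> ('i \<Rightarrow> nat list) \<Rightarrow> ('i \<Rightarrow> nat) \<Rightarrow> bool" where
  "fpt Inst Yes enc \<kappa> \<longleftrightarrow>
     (\<exists>c f a. computable f \<and>
        (\<forall>I\<in>Inst. \<exists>t. halts_with c (enc I) t (if I \<in> Yes then 1 else 0) \<and>
           t \<le> f (\<kappa> I) * bit_size (enc I) ^ a))"


section \<open>Encoded instances of Terminal Monitoring Set\<close>

text \<open>
  Encoded instances have vertex set \<open>{0, \<dots>, n - 1}\<close>. The encoding consists of \<open>n\<close>, of the bound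
  \<open>k\<close>, and of two 0/1-matrices in row-major order: the adjacency matrix and the matrix of the
  terminal pairs. Since an instance lists its vertices, using matrices instead of lists of edges
  and of terminal pairs changes the instance size at most polynomially.
\<close>

definition tms_instances :: "nat tms set" where
  "tms_instances = {I. tms_wf I \<and> (\<exists>n. pverts (tms_graph I) = {..<n})}"

definition bool_matrix :: "nat \<Rightarrow> (nat \<Rightarrow> nat \<Rightarrow> bool) \<Rightarrow> nat list" where
  "bool_matrix n M = concat (map (\<lambda>u. map (\<lambda>v. of_bool (M u v)) [0..<n]) [0..<n])"

definition tms_encode :: "nat tms \<Rightarrow> nat list" where
  "tms_encode I =
     (let n = card (pverts (tms_graph I))
      in [n, tms_bound I] @
         bool_matrix n (\<lambda>u v. (u, v) \<in> parcs (tms_graph I)) @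
         bool_matrix n (\<lambda>u v. {u, v} \<in> tms_pairs I))"

definition tms_parameter :: "'a tms \<Rightarrow> nat" where
  "tms_parameter I = tms_bound I + neighborhood_diversity (tms_graph I)"

end

theory Submission
  imports Defs "HOL-Combinatorics.Transposition"
begin

text \<open>
  A vertex \<open>w\<close> different from \<open>u\<close> and \<open>v\<close> that monitors \<open>{u, v}\<close> has neither the type of \<open>u\<close> nor
  that of \<open>v\<close>, and can be replaced by any vertex of its type, because exchanging two vertices of
  the same type is an automorphism. Hence it suffices to guess the set \<open>X\<close> of the types hit by a
  solution (one bit per type) and, for every terminal pair that is monitored neither by a type
  in \<open>X\<close> nor by an endpoint chosen before, which of its endpoints to choose (one bit per
  chosen endpoint, of which there are at most \<open>k\<close>). The guess succeeds if the number of chosen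
  endpoints plus the number of types in \<open>X\<close> that they miss is at most \<open>k\<close>. There are at most
  \<open>2 ^ (k + t)\<close> guesses; a guess is a number whose binary digits are consumed by halving it.
\<close>


section \<open>Total correctness of programs with exact running times\<close>

text \<open>The exchange argument fails for endpoints: \<open>u\<close> monitors
  \<open>{u, v}\<close>, but another vertex of its type need not. Hence types suffice for monitoring
  vertices other than the endpoints, while endpoints have to be chosen as concrete vertices. The
  branch of the resulting search tree that follows a given solution makes at most \<open>k\<close>
  choices. Since a guess names a branch, the machine runs through numbers in a flat loop and keeps
  no stack. Other guesses do no harm: each guess that passes the cost test describes a genuine
  solution, so the range of guesses matters for completeness only. The neighborhood diversity is not
  part of the input; the machine computes the types itself, and their number is at most
  \<open>t\<close>.

  The machine has no multiplication and no division. Products \<open>u * n\<close> come from a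
  table, and a digit is split off by counting up to the half, in time linear in the guess. There are
  at most \<open>2 ^ (k + t)\<close> guesses, each of them smaller than that number, which is where
  the parameter function \<open>4 ^ (k + t)\<close> comes from.\<close>

definition wp :: "nat list \<Rightarrow> com \<Rightarrow> (nat \<Rightarrow> memory \<Rightarrow> bool) \<Rightarrow> memory \<Rightarrow> bool" where
  "wp xs c Q m \<longleftrightarrow> (\<exists>t m'. exec xs c m t m' \<and> Q t m')"

lemma wp_Skip [simp]: "wp xs Skip Q m \<longleftrightarrow> Q 1 m"
  unfolding wp_def by (auto intro: exec.intros[unfolded One_nat_def] elim: exec_SkipE)

lemma wp_Store [simp]: "wp xs (Store a e) Q m \<longleftrightarrow> Q 1 (m(val xs m a := val xs m e))"
  unfolding wp_def by (auto intro: exec.intros[unfolded One_nat_def] elim: exec_StoreE)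

lemma wp_Seq [simp]: "wp xs (Seq c d) Q m \<longleftrightarrow> wp xs c (\<lambda>t. wp xs d (\<lambda>t'. Q (t + t'))) m"
proof -
  have "exec xs (Seq c d) m t m' \<longleftrightarrow> (\<exists>t1 t2 m1. t = t1 + t2 \<and> exec xs c m t1 m1 \<and> exec xs d m1 t2 m')"
    for t m'
    by (rule iffI, erule exec_SeqE) (metis, metis exec.Seq)
  then show ?thesis unfolding wp_def by (simp add: ex_simps) metis
qed

text \<open>After one sequence is unfolded, the rest of the program occurs without its memory
  argument, where \<open>wp_Seq\<close> does not match.\<close>

lemma wp_Seq_fun: "wp xs (Seq c d) Q = wp xs c (\<lambda>t. wp xs d (\<lambda>t'. Q (t + t')))"
  by (rule ext) (rule wp_Seq)

lemma wp_If [simp]: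
  "wp xs (If b c d) Q m \<longleftrightarrow>
     (if val xs m b \<noteq> 0 then wp xs c (\<lambda>t. Q (1 + t)) m else wp xs d (\<lambda>t. Q (1 + t)) m)"
proof (cases "val xs m b = 0")
  case True
  then have "exec xs (If b c d) m t m' \<longleftrightarrow> (\<exists>t'. t = 1 + t' \<and> exec xs d m t' m')" for t m'
    by (intro iffI; (elim exec_IfE)?) (simp, simp, metis exec.IfFalse)
  with True show ?thesis unfolding wp_def by auto
next
  case False
  then have "exec xs (If b c d) m t m' \<longleftrightarrow> (\<exists>t'. t = 1 + t' \<and> exec xs c m t' m')" for t m'
    by (intro iffI; (elim exec_IfE)?) (simp, simp, metis exec.IfTrue)
  with False show ?thesis unfolding wp_def by auto
qed

lemma wp_mono: "wp xs c Q m \<Longrightarrow> (\<And>t m'. Q t m' \<Longrightarrow> Q' t m') \<Longrightarrow> wp xs c Q' m"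
  unfolding wp_def by blast

lemma wp_While_True:
  assumes "val xs m b \<noteq> 0" "wp xs c (\<lambda>t. wp xs (While b c) (\<lambda>t'. Q (1 + t + t'))) m"
  shows "wp xs (While b c) Q m"
proof -
  from assms(2) obtain t m1 t' m2
    where "exec xs c m t m1" "exec xs (While b c) m1 t' m2" "Q (1 + t + t') m2"
    unfolding wp_def by blast
  with exec.WhileTrue[OF assms(1)] show ?thesis unfolding wp_def by metis
qed

lemma wp_While_False: "val xs m b = 0 \<Longrightarrow> Q 1 m \<Longrightarrow> wp xs (While b c) Q m"
  unfolding wp_def by (metis exec.WhileFalse)


text \<open>
  The memory is split into 32 interleaved unbounded arrays; the factor 32 is affordable because
  multiplication by it amounts to five doublings. A scalar variable is entry 0 of an array of its
  own, and the output cell is entry 0 of array 0.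
\<close>

definition loc :: "nat \<Rightarrow> nat \<Rightarrow> nat" where
  "loc j i = 32 * i + j"

lemma loc_eq_iff [simp]:
  assumes "j < 32" "j' < 32"
  shows "loc j i = loc j' i' \<longleftrightarrow> j = j' \<and> i = i'"
proof
  assume eq: "loc j i = loc j' i'"
  from arg_cong[OF eq, of "\<lambda>a. a mod 32"] arg_cong[OF eq, of "\<lambda>a. a div 32"]
  show "j = j' \<and> i = i'" using assms by (simp add: loc_def)
qed simp

definition Dbl :: "exp \<Rightarrow> exp" where
  "Dbl e = Add e e"

definition At :: "nat \<Rightarrow> exp \<Rightarrow> exp" where
  "At j e = Add (Const j) (Dbl (Dbl (Dbl (Dbl (Dbl e)))))"

text \<open>Truncated subtraction is the source of all tests: \<open>1 - x\<close> is the truth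
  value of \<open>x = 0\<close>, and two numbers are equal iff both of their differences
  vanish.\<close>

definition Neg :: "exp \<Rightarrow> exp" where
  "Neg e = Sub (Const 1) e"

definition Conj :: "exp \<Rightarrow> exp \<Rightarrow> exp" where
  "Conj e e' = Neg (Add (Neg e) (Neg e'))"

definition Same :: "exp \<Rightarrow> exp \<Rightarrow> exp" where
  "Same e e' = Neg (Add (Sub e e') (Sub e' e))"

abbreviation "Arr j e \<equiv> Mem (At j e)"
abbreviation "Var j \<equiv> Mem (At j (Const 0))"
abbreviation "Assign j e \<equiv> Store (At j (Const 0)) e"

lemma val_At [simp]: "val xs m (At j e) = loc j (val xs m e)"
  by (simp add: At_def Dbl_def loc_def)

lemma At_eq_iff [simp]: "At j e = At j' e' \<longleftrightarrow> j = j' \<and> e = e'"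
  by (auto simp: At_def Dbl_def)

lemma val_Neg [simp]: "val xs m (Neg e) = of_bool (val xs m e = 0)"
  by (simp add: Neg_def)

lemma val_Conj [simp]: "val xs m (Conj e e') = of_bool (val xs m e \<noteq> 0 \<and> val xs m e' \<noteq> 0)"
  by (simp add: Conj_def)

lemma val_Same [simp]: "val xs m (Same e e') = of_bool (val xs m e = val xs m e')"
  by (auto simp: Same_def)

section \<open>Frame conditions: the arrays that a program may change\<close>

primrec writes :: "nat set \<Rightarrow> com \<Rightarrow> bool" where
  "writes W Skip = True"
| "writes W (Store a e) = (\<exists>j\<in>W. \<exists>e'. a = At j e')"
| "writes W (Seq c d) = (writes W c \<and> writes W d)"
| "writes W (If b c d) = (writes W c \<and> writes W d)"
| "writes W (While b c) = writes W c"

lemma writes_At [simp]: "j \<in> W \<Longrightarrow> writes W (Store (At j e) e')"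
  by auto

lemma writes_mono: "writes W c \<Longrightarrow> W \<subseteq> W' \<Longrightarrow> writes W' c"
  by (induction c) auto

definition agree_off :: "nat set \<Rightarrow> memory \<Rightarrow> memory \<Rightarrow> bool" where
  "agree_off W m m' \<longleftrightarrow> (\<forall>j<32. j \<notin> W \<longrightarrow> (\<forall>i. m' (loc j i) = m (loc j i)))"

lemma agree_offD: "agree_off W m m' \<Longrightarrow> j < 32 \<Longrightarrow> j \<notin> W \<Longrightarrow> m' (loc j i) = m (loc j i)"
  by (simp add: agree_off_def)

lemma agree_off_refl [simp]: "agree_off W m m"
  by (simp add: agree_off_def)

lemma agree_off_trans: "agree_off W m m' \<Longrightarrow> agree_off W m' m'' \<Longrightarrow> agree_off W m m''"
  by (simp add: agree_off_def)

lemma agree_off_mono: "agree_off W m m' \<Longrightarrow> W \<subseteq> W' \<Longrightarrow> agree_off W' m m'"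
  by (auto simp: agree_off_def)

lemma agree_off_upd: "j \<in> W \<Longrightarrow> W \<subseteq> {..<32} \<Longrightarrow> agree_off W m m' \<Longrightarrow> agree_off W m (m'(loc j i := x))"
  by (fastforce simp: agree_off_def)

text \<open>A store through \<open>At j\<close> hits a cell of array \<open>j\<close>, whatever the
  index evaluates to, and arrays with different numbers below 32 are disjoint. So a purely syntactic
  check yields the frame.\<close>

lemma exec_writes: "exec xs c m t m' \<Longrightarrow> writes W c \<Longrightarrow> W \<subseteq> {..<32} \<Longrightarrow> agree_off W m m'"
proof (induction rule: exec.induct)
  case (Store a e m)
  then obtain j e' where "j \<in> W" "a = At j e'" by auto
  show ?case
    unfolding \<open>a = At j e'\<close> val_At by (rule agree_off_upd) (use \<open>j \<in> W\<close> Store in auto)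
qed (auto intro: agree_off_trans)

lemma wp_frame:
  assumes "wp xs c Q m" "writes W c" "W \<subseteq> {..<32}"
  shows "wp xs c (\<lambda>t m'. Q t m' \<and> agree_off W m m') m"
  using assms exec_writes unfolding wp_def by blast

section \<open>Bounded loops and bounded search\<close>

definition For :: "nat \<Rightarrow> exp \<Rightarrow> com \<Rightarrow> com" where
  "For x e c = Seq (Assign x (Const 0)) (While (Sub e (Var x)) (Seq c (Assign x (Add (Var x) (Const 1)))))"

lemma writes_For [simp]: "x \<in> W \<Longrightarrow> writes W (For x e c) \<longleftrightarrow> writes W c"
  by (auto simp: For_def)

text \<open>The loop bound is evaluated again in every round, so it must have the same value in all
  memories that the loop can reach. The frame is part of the rule; an invariant therefore speaks
  only of what the body computes. A round costs the body, the guard and the increment; the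
  initialization and the last guard add 2.\<close>

lemma wp_For:
  fixes N T :: nat
  assumes W: "writes W c" "W \<subseteq> {..<32}" "x \<notin> W" "x < 32"
    and bound: "\<And>m'. agree_off (insert x W) m m' \<Longrightarrow> val xs m' e = N"
    and base: "Inv 0 (m(loc x 0 := 0))"
    and step: "\<And>i m'. i < N \<Longrightarrow> Inv i m' \<Longrightarrow> m' (loc x 0) = i \<Longrightarrow> agree_off (insert x W) m m' \<Longrightarrow>
      wp xs c (\<lambda>t m''. t \<le> T \<and> Inv (Suc i) (m''(loc x 0 := Suc i))) m'"
  shows "wp xs (For x e c) (\<lambda>t m'. t \<le> 2 + N * (T + 2) \<and> Inv N m' \<and> agree_off (insert x W) m m') m"
proof -
  have W': "insert x W \<subseteq> {..<32}" using W by auto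
  define L where "L = While (Sub e (Var x)) (Seq c (Assign x (Add (Var x) (Const 1))))"
  have loop: "wp xs L (\<lambda>t m''. t \<le> 1 + (N - i) * (T + 2) \<and> Inv N m'' \<and> agree_off (insert x W) m m'') m'"
    if "i \<le> N" "Inv i m'" "m' (loc x 0) = i" "agree_off (insert x W) m m'" for i m'
    using that
  proof (induction "N - i" arbitrary: i m')
    case 0
    then show ?case
      unfolding L_def by (intro wp_While_False) (auto simp: bound)
  next
    case (Suc d)
    have "wp xs c (\<lambda>t m''. (t \<le> T \<and> Inv (Suc i) (m''(loc x 0 := Suc i))) \<and> agree_off W m' m'') m'"
      by (rule wp_frame[OF step]) (use Suc W in auto)
    moreover have "wp xs (Assign x (Add (Var x) (Const 1)))
        (\<lambda>t'. wp xs L (\<lambda>t'' m3. 1 + (t + t') + t'' \<le> 1 + (N - i) * (T + 2) \<and> Inv N m3 \<and>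
          agree_off (insert x W) m m3)) m''"
      if *: "(t \<le> T \<and> Inv (Suc i) (m''(loc x 0 := Suc i))) \<and> agree_off W m' m''" for t m''
    proof -
      have "agree_off (insert x W) m m''"
        using Suc.prems * by (meson agree_off_mono agree_off_trans subset_insertI)
      then have **: "agree_off (insert x W) m (m''(loc x 0 := Suc i))"
        using W' by (intro agree_off_upd) auto
      have d: "N - i = Suc (N - Suc i)" using Suc.hyps by simp
      have x: "m'' (loc x 0) = i"
        using * agree_offD[of W m' m'' x 0] W Suc.prems by simp
      have "wp xs L (\<lambda>t m''. t \<le> 1 + (N - Suc i) * (T + 2) \<and> Inv N m'' \<and>
          agree_off (insert x W) m m'') (m''(loc x 0 := Suc i))"
        using Suc.hyps * ** by (intro Suc.hyps(1)) auto
      then have "wp xs L (\<lambda>t'' m3. 1 + (t + 1) + t'' \<le> 1 + (N - i) * (T + 2) \<and> Inv N m3 \<and>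
          agree_off (insert x W) m m3) (m''(loc x 0 := Suc i))"
        by (rule wp_mono) (use * in \<open>auto simp: d\<close>)
      with x show ?thesis by simp
    qed
    ultimately have "wp xs c (\<lambda>t. wp xs (Assign x (Add (Var x) (Const 1)))
        (\<lambda>t'. wp xs L (\<lambda>t'' m3. 1 + (t + t') + t'' \<le> 1 + (N - i) * (T + 2) \<and> Inv N m3 \<and>
          agree_off (insert x W) m m3))) m'"
      by (rule wp_mono)
    then have "wp xs (Seq c (Assign x (Add (Var x) (Const 1))))
        (\<lambda>t. wp xs L (\<lambda>t'. \<lambda>m3. 1 + t + t' \<le> 1 + (N - i) * (T + 2) \<and> Inv N m3 \<and>
          agree_off (insert x W) m m3)) m'"
      by (simp only: wp_Seq)
    moreover have "val xs m' (Sub e (Var x)) \<noteq> 0"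
      using Suc by (simp add: bound)
    ultimately show ?case
      unfolding L_def by (intro wp_While_True)
  qed
  have "wp xs L (\<lambda>t m'. t \<le> 1 + (N - 0) * (T + 2) \<and> Inv N m' \<and> agree_off (insert x W) m m')
      (m(loc x 0 := 0))"
    by (rule loop) (use base agree_off_upd[OF insertI1 W' agree_off_refl] in auto)
  then have "wp xs L (\<lambda>t m'. 1 + t \<le> 2 + N * (T + 2) \<and> Inv N m' \<and> agree_off (insert x W) m m')
      (m(loc x 0 := 0))"
    by (rule wp_mono) auto
  then show ?thesis
    unfolding For_def L_def[symmetric] by simp
qed

text \<open>\<open>Inv i j\<close> describes the moment when the rows before \<open>i\<close> and
  the first \<open>j\<close> columns of row \<open>i\<close> are done; \<open>row\<close> identifies
  the end of a row with the start of the next one. By \<open>upd\<close> the invariant ignores the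
  counters themselves.\<close>

lemma wp_For_For:
  fixes N T :: nat
  assumes W: "writes W c" "W \<subseteq> {..<32}" "x \<notin> W" "y \<notin> W" "x < 32" "y < 32" "x \<noteq> y"
    and bound: "\<And>m'. val xs m' e = N"
    and base: "Inv 0 0 m"
    and row: "\<And>i m'. Inv i N m' \<Longrightarrow> Inv (Suc i) 0 m'"
    and upd: "\<And>i j a m'. Inv i j m' \<Longrightarrow> Inv i j (m'(loc x 0 := a))"
      "\<And>i j a m'. Inv i j m' \<Longrightarrow> Inv i j (m'(loc y 0 := a))"
    and step: "\<And>i j m'. i < N \<Longrightarrow> j < N \<Longrightarrow> Inv i j m' \<Longrightarrow> m' (loc x 0) = i \<Longrightarrow> m' (loc y 0) = j \<Longrightarrow>
      agree_off (insert x (insert y W)) m m' \<Longrightarrow> wp xs c (\<lambda>t m''. t \<le> T \<and> Inv i (Suc j) m'') m'"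
  shows "wp xs (For x e (For y e c))
    (\<lambda>t m'. t \<le> 2 + N * ((2 + N * (T + 2)) + 2) \<and> Inv N 0 m' \<and> agree_off (insert x (insert y W)) m m') m"
proof -
  show ?thesis
  proof (rule wp_For[where Inv = "\<lambda>i. Inv i 0" and W = "insert y W"])
    fix i m1 assume 1: "i < N" "Inv i 0 m1" "m1 (loc x 0) = i" "agree_off (insert x (insert y W)) m m1"
    have "wp xs (For y e c)
      (\<lambda>t m'. t \<le> 2 + N * (T + 2) \<and> Inv i N m' \<and> agree_off (insert y W) m1 m') m1"
    proof (rule wp_For[where Inv = "Inv i" and W = W])
      fix j m2 assume 2: "j < N" "Inv i j m2" "m2 (loc y 0) = j" "agree_off (insert y W) m1 m2"
      have "agree_off (insert x (insert y W)) m m2"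
        by (rule agree_off_trans[OF 1(4) agree_off_mono[OF 2(4)]]) auto
      moreover have "m2 (loc x 0) = i" using agree_offD[OF 2(4), of x 0] W 1(3) by simp
      ultimately have "wp xs c (\<lambda>t m''. t \<le> T \<and> Inv i (Suc j) m'') m2"
        using step 1 2 by simp
      then show "wp xs c (\<lambda>t m''. t \<le> T \<and> Inv i (Suc j) (m''(loc y 0 := Suc j))) m2"
        by (rule wp_mono) (simp add: upd)
    qed (use W bound upd 1 in auto)
    then show "wp xs (For y e c)
        (\<lambda>t m''. t \<le> 2 + N * (T + 2) \<and> Inv (Suc i) 0 (m''(loc x 0 := Suc i))) m1"
      by (rule wp_mono) (simp add: upd row)
  next
    show "writes (insert y W) (For y e c)" using writes_mono[OF W(1), of "insert y W"] by auto
  qed (use W bound base upd in auto)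
qed

definition Exists :: "nat \<Rightarrow> nat \<Rightarrow> exp \<Rightarrow> exp \<Rightarrow> com" where
  "Exists f x e b = Seq (Assign f (Const 0)) (For x e (If b (Assign f (Const 1)) Skip))"

lemma writes_Exists [simp]: "f \<in> W \<Longrightarrow> x \<in> W \<Longrightarrow> writes W (Exists f x e b)"
  unfolding Exists_def by auto

text \<open>The search does not stop at a hit: the flag is never reset, so it accumulates the
  disjunction. Guard and branch cost 2 steps per candidate.\<close>

lemma wp_Exists:
  assumes "f < 32" "x < 32" "f \<noteq> x"
    and bound: "\<And>m'. agree_off {x, f} m m' \<Longrightarrow> val xs m' e = N"
    and test: "\<And>m' i. agree_off {x, f} m m' \<Longrightarrow> m' (loc x 0) = i \<Longrightarrow> i < N \<Longrightarrow> val xs m' b \<noteq> 0 \<longleftrightarrow> P i"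
  shows "wp xs (Exists f x e b) (\<lambda>t m'. t \<le> 3 + 4 * N \<and> m' (loc f 0) = of_bool (\<exists>i<N. P i) \<and>
    agree_off {x, f} m m') m"
proof -
  define m0 where "m0 = m(loc f 0 := 0)"
  have m0: "agree_off {x, f} m m0"
    using assms(1,2) by (simp add: m0_def agree_off_upd)
  have "wp xs (For x e (If b (Assign f (Const 1)) Skip))
    (\<lambda>t m'. t \<le> 2 + N * (2 + 2) \<and> m' (loc f 0) = of_bool (\<exists>i<N. P i) \<and> agree_off {x, f} m0 m') m0"
  proof (rule wp_For[where Inv = "\<lambda>n m'. m' (loc f 0) = of_bool (\<exists>j<n. P j)"])
    fix i m' assume *: "i < N" "m' (loc f 0) = of_bool (\<exists>j<i. P j)" "m' (loc x 0) = i"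
      "agree_off (insert x {f}) m0 m'"
    have "val xs m' b \<noteq> 0 \<longleftrightarrow> P i"
      by (rule test[OF agree_off_trans[OF m0]]) (use * in auto)
    then show "wp xs (If b (Assign f (Const 1)) Skip)
      (\<lambda>t m''. t \<le> 2 \<and> (m''(loc x 0 := Suc i)) (loc f 0) = of_bool (\<exists>j<Suc i. P j)) m'"
      using * assms(1-3) by (auto simp: less_Suc_eq)
  next
    fix m' assume "agree_off (insert x {f}) m0 m'"
    then show "val xs m' e = N" by (rule bound[OF agree_off_trans[OF m0]])
  qed (use assms(1-3) in \<open>auto simp: m0_def\<close>)
  then have "wp xs (For x e (If b (Assign f (Const 1)) Skip))
    (\<lambda>t m'. 1 + t \<le> 3 + 4 * N \<and> m' (loc f 0) = of_bool (\<exists>i<N. P i) \<and> agree_off {x, f} m m') m0"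
    by (rule wp_mono) (use agree_off_trans[OF m0] in auto)
  then show ?thesis
    by (simp only: Exists_def wp_Seq wp_Store val_At val.simps m0_def)
qed

section \<open>Distances and types\<close>

context pair_graph
begin

text \<open>Relation powers replace walks from here on. The condition on \<open>u\<close> excludes
  the empty walk at a non-vertex, which \<open>parcs G ^^ 0\<close> would admit.\<close>

lemma awalk_iff_relpow:
  "(\<exists>p. awalk u p v \<and> length p = s) \<longleftrightarrow> u \<in> pverts G \<and> (u, v) \<in> parcs G ^^ s"
proof (induction s arbitrary: u)
  case 0
  then show ?case by (auto simp: awalk_Nil_iff)
next
  case (Suc s)
  have "(\<exists>p. awalk u p v \<and> length p = Suc s) \<longleftrightarrow>
      (\<exists>e p. awalk u (e # p) v \<and> length p = s)"
    by (metis length_Suc_conv)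
  also have "\<dots> \<longleftrightarrow> (\<exists>w. (u, w) \<in> parcs G \<and> (\<exists>p. awalk w p v \<and> length p = s))"
    by (auto simp: awalk_Cons_iff)
  also have "\<dots> \<longleftrightarrow> (\<exists>w. (u, w) \<in> parcs G \<and> (w, v) \<in> parcs G ^^ s)"
    unfolding Suc using in_arcsD2 by blast
  also have "\<dots> \<longleftrightarrow> u \<in> pverts G \<and> (u, v) \<in> parcs G ^^ Suc s"
    using in_arcsD1 by (auto simp: relpow_commute intro: relpow_Suc_I2 dest: relpow_Suc_D2 simp del: relpow.simps)
  finally show ?case .
qed

lemma gdist_eq_INF:
  assumes "u \<in> pverts G"
  shows "gdist G u v = (INF s\<in>{s. (u, v) \<in> parcs G ^^ s}. ereal (real s))"
proof -
  have cost: "awalk_cost (\<lambda>_. 1) p = real (length p)" for p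
    by (induction p) auto
  have walks: "length ` {p. awalk u p v} = {s. (u, v) \<in> parcs G ^^ s}"
    using awalk_iff_relpow[of u v] assms by (simp add: set_eq_iff image_iff) metis
  then show ?thesis
    unfolding gdist_def \<mu>_def cost by (simp add: image_image flip: walks)
qed

text \<open>The distance as a natural number. It is meaningful only if \<open>v\<close> can be
  reached from \<open>u\<close>; otherwise \<open>LEAST\<close> is unspecified, so its uses are
  guarded by the existence of a walk.\<close>

definition steps :: "'a \<Rightarrow> 'a \<Rightarrow> nat" where
  "steps u v = (LEAST s. (u, v) \<in> parcs G ^^ s)"

lemma steps_le: "(u, v) \<in> parcs G ^^ s \<Longrightarrow> steps u v \<le> s"
  unfolding steps_def by (rule Least_le)

lemma relpow_steps: "(u, v) \<in> parcs G ^^ s \<Longrightarrow> (u, v) \<in> parcs G ^^ steps u v"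
  unfolding steps_def by (rule LeastI)

lemma gdist_eq_steps:
  assumes "u \<in> pverts G" "(u, v) \<in> parcs G ^^ s"
  shows "gdist G u v = ereal (real (steps u v))"
  unfolding gdist_eq_INF[OF assms(1)]
  by (intro antisym INF_lower2[of "steps u v"] INF_greatest)
    (use relpow_steps[OF assms(2)] in \<open>auto intro: steps_le\<close>)

lemma gdist_eq_infinity:
  assumes "u \<in> pverts G" "\<And>s. (u, v) \<notin> parcs G ^^ s"
  shows "gdist G u v = \<infinity>"
  using assms by (simp add: gdist_eq_INF top_ereal_def)

lemma gdist_less_infinity_iff:
  "u \<in> pverts G \<Longrightarrow> gdist G u v < \<infinity> \<longleftrightarrow> (\<exists>s. (u, v) \<in> parcs G ^^ s)"
  by (cases "\<exists>s. (u, v) \<in> parcs G ^^ s") (auto simp: gdist_eq_steps gdist_eq_infinity)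

lemma gdist_nonneg: "u \<in> pverts G \<Longrightarrow> 0 \<le> gdist G u v"
  unfolding gdist_eq_INF by (auto intro: INF_greatest)

lemma gdist_self [simp]: "u \<in> pverts G \<Longrightarrow> gdist G u u = 0"
proof -
  assume u: "u \<in> pverts G"
  have *: "(u, u) \<in> parcs G ^^ 0" by simp
  from steps_le[OF *] gdist_eq_steps[OF u *] show ?thesis by simp
qed

lemma gdist_eq_0D:
  assumes "u \<in> pverts G" "gdist G u v = 0"
  shows "u = v"
proof -
  obtain s where s: "(u, v) \<in> parcs G ^^ s"
    using gdist_less_infinity_iff[of u v] assms by auto
  then have "steps u v = 0" using assms by (simp add: gdist_eq_steps)
  with relpow_steps[OF s] show ?thesis by simp
qed

section \<open>Types, and the exchange of two vertices of the same type\<close>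

lemma same_type_iff:
  "same_type G u v \<longleftrightarrow> (\<forall>w. w \<noteq> u \<longrightarrow> w \<noteq> v \<longrightarrow> (u, w) \<in> parcs G \<longleftrightarrow> (v, w) \<in> parcs G)"
  unfolding same_type_def nbhd_def set_eq_iff by simp (metis no_loops')

lemma same_type_refl [simp]: "same_type G u u"
  by (simp add: same_type_iff)

lemma same_type_sym: "same_type G u v \<Longrightarrow> same_type G v u"
  by (auto simp: same_type_iff)

text \<open>The only delicate vertex is the middle one, \<open>v\<close>, about which neither
  hypothesis speaks. There a detour helps: \<open>u\<close> is adjacent to \<open>v\<close> iff
  \<open>w\<close> is adjacent to \<open>u\<close> (types of \<open>v\<close> and \<open>w\<close>)
  iff \<open>w\<close> is adjacent to \<open>v\<close> (types of \<open>u\<close> and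
  \<open>v\<close>).\<close>

lemma same_type_trans:
  assumes "same_type G u v" "same_type G v w"
  shows "same_type G u w"
proof -
  have "(u, x) \<in> parcs G \<longleftrightarrow> (w, x) \<in> parcs G" if "x \<noteq> u" "x \<noteq> w" for x
  proof (cases "x = v")
    case True
    have "(u, v) \<in> parcs G \<longleftrightarrow> (w, v) \<in> parcs G" if "u \<noteq> w"
    proof -
      have "(u, v) \<in> parcs G \<longleftrightarrow> (w, u) \<in> parcs G"
        using assms(2) that \<open>x \<noteq> u\<close> True arcs_symmetric unfolding same_type_iff by metis
      also have "\<dots> \<longleftrightarrow> (w, v) \<in> parcs G"
        using assms(1) that \<open>x \<noteq> w\<close> True arcs_symmetric unfolding same_type_iff by metis
      finally show ?thesis .
    qed
    with True show ?thesis by auto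
  next
    case False
    then show ?thesis using assms that unfolding same_type_iff by metis
  qed
  then show ?thesis by (simp add: same_type_iff)
qed

text \<open>An arc between \<open>a\<close> and \<open>b\<close> is reversed, and an arc that meets
  \<open>{a, b}\<close> in one end is moved to the other vertex because the types agree at its other
  end.\<close>

lemma same_type_transpose_arc:
  assumes "same_type G a b" "(x, y) \<in> parcs G"
  shows "(transpose a b x, transpose a b y) \<in> parcs G"
proof -
  have sym: "(p, q) \<in> parcs G \<longleftrightarrow> (q, p) \<in> parcs G" for p q
    by (rule iffI) (rule arcs_symmetric, assumption)+
  have out: "(a, z) \<in> parcs G \<longleftrightarrow> (b, z) \<in> parcs G" if "z \<noteq> a" "z \<noteq> b" for z
    using assms(1) that by (simp add: same_type_iff)
  have inw: "(z, a) \<in> parcs G \<longleftrightarrow> (z, b) \<in> parcs G" if "z \<noteq> a" "z \<noteq> b" for z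
    unfolding sym[of z] using out[OF that] .
  have "x \<noteq> y" "(y, x) \<in> parcs G"
    using assms(2) by (rule no_loops', rule arcs_symmetric)
  then consider "x = a" "y = b" | "x = b" "y = a" | "x = a" "y \<noteq> a" "y \<noteq> b" | "x = b" "y \<noteq> a" "y \<noteq> b"
    | "x \<noteq> a" "x \<noteq> b" "y = a" | "x \<noteq> a" "x \<noteq> b" "y = b" | "x \<noteq> a" "x \<noteq> b" "y \<noteq> a" "y \<noteq> b"
    by blast
  then show ?thesis
    by cases (use assms(2) \<open>(y, x) \<in> parcs G\<close> out[of y] inw[of x] in simp_all)
qed

lemma same_type_transpose_relpow:
  assumes "same_type G a b" "(x, y) \<in> parcs G ^^ s"
  shows "(transpose a b x, transpose a b y) \<in> parcs G ^^ s"
  using assms(2)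
proof (induction s arbitrary: y)
  case (Suc s)
  then show ?case using same_type_transpose_arc[OF assms(1)] by (auto intro: relcompI)
qed auto

text \<open>A transposition is its own inverse, so mapping walks to walks already gives an
  equivalence and thereby equal infima.\<close>

lemma same_type_transpose_gdist:
  assumes "same_type G a b" "a \<in> pverts G" "b \<in> pverts G" "x \<in> pverts G"
  shows "gdist G (transpose a b x) (transpose a b y) = gdist G x y"
proof -
  have "transpose a b x \<in> pverts G" using assms by (auto simp: transpose_def)
  moreover have "(transpose a b x, transpose a b y) \<in> parcs G ^^ s \<longleftrightarrow> (x, y) \<in> parcs G ^^ s" for s
    using same_type_transpose_relpow[OF assms(1), of "transpose a b x" "transpose a b y" s]
      same_type_transpose_relpow[OF assms(1), of x y s] by auto
  ultimately show ?thesis using assms(4) by (simp add: gdist_eq_INF)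
qed

definition monitors :: "'a \<Rightarrow> 'a \<Rightarrow> 'a \<Rightarrow> bool" where
  "monitors w u v \<longleftrightarrow> gdist G u w + gdist G w v = gdist G u v"

lemma monitors_endpoint: "u \<in> pverts G \<Longrightarrow> v \<in> pverts G \<Longrightarrow> monitors u u v \<and> monitors v u v"
  by (simp add: monitors_def)

text \<open>If \<open>w'\<close> were \<open>u\<close>, exchanging \<open>w\<close> and
  \<open>u\<close> would give \<open>d(w, v) = d(u, v)\<close>; cancelling this finite value leaves
  \<open>d(u, w) = 0\<close>, contradicting \<open>w \<noteq> u\<close>. The case
  \<open>w' = v\<close> is symmetric. Otherwise the exchange fixes \<open>u\<close> and
  \<open>v\<close> and carries \<open>w\<close> to \<open>w'\<close>.\<close>

lemma monitors_same_type:
  assumes "monitors w u v" "w \<noteq> u" "w \<noteq> v" "same_type G w w'"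
    and V: "u \<in> pverts G" "v \<in> pverts G" "w \<in> pverts G" "w' \<in> pverts G"
    and fin: "gdist G u v < \<infinity>"
  shows "monitors w' u v \<and> w' \<noteq> u \<and> w' \<noteq> v"
proof -
  note tr = same_type_transpose_gdist[OF assms(4) V(3,4)]
  have pos: "gdist G u w \<noteq> 0" "gdist G w v \<noteq> 0"
    using gdist_eq_0D[of u w] gdist_eq_0D[of w v] V assms(2,3) by auto
  have nn: "0 \<le> gdist G u w" "0 \<le> gdist G w v" "0 \<le> gdist G u v" using gdist_nonneg V by auto
  have mon: "gdist G u w + gdist G w v = gdist G u v" using assms(1) by (simp add: monitors_def)
  have "w' \<noteq> u"
  proof
    assume w': "w' = u"
    \<comment> \<open>For \<open>u = v\<close> the distance is 0, which a vertex at positive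
      distance from \<open>u\<close> cannot attain. So the exchange of \<open>w\<close> and
      \<open>u\<close> fixes \<open>v\<close>.\<close>
    have "u \<noteq> v" using mon pos(1) nn(1,2) gdist_self[OF V(1)]
      by (cases "gdist G u w"; cases "gdist G w v") auto
    then have "gdist G w v = gdist G u v"
      using tr[of u v] w' assms(2,3) V by (simp add: transpose_def)
    then show False using mon pos nn fin
      by (cases "gdist G u w"; cases "gdist G u v") auto
  qed
  moreover have "w' \<noteq> v"
  proof
    assume w': "w' = v"
    have "u \<noteq> v" using mon pos(1) nn(1,2) gdist_self[OF V(1)]
      by (cases "gdist G u w"; cases "gdist G w v") auto
    then have "gdist G u w = gdist G u v"
      using tr[of u v] w' assms(2,3) V by (simp add: transpose_def)
    then show False using mon pos nn fin
      by (cases "gdist G w v"; cases "gdist G u v") auto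
  qed
  moreover have "monitors w' u v"
    using tr[of u w] tr[of w v] mon calculation V assms(2,3)
    by (simp add: monitors_def transpose_def)
  ultimately show ?thesis by simp
qed

end

section \<open>Guessing a solution\<close>

locale tms_instance = pair_graph G for G :: "nat pair_pre_digraph" +
  fixes Tp :: "nat set set" and k n :: nat
  assumes verts: "pverts G = {..<n}"
    and finite_dist: "\<And>u v. {u, v} \<in> Tp \<Longrightarrow> gdist G u v < \<infinity>"
    and pair_verts: "\<And>u v. {u, v} \<in> Tp \<Longrightarrow> u < n \<and> v < n"
begin

text \<open>The largest vertex represents its type, because an ascending scan that overwrites its
  result ends with it.\<close>

definition cls :: "nat \<Rightarrow> nat" where
  "cls v = Max {u. u < n \<and> same_type G u v}"

lemma cls:
  assumes "v < n"
  shows "cls v < n" "same_type G (cls v) v"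
proof -
  have "cls v \<in> {u. u < n \<and> same_type G u v}"
    unfolding cls_def using assms by (intro Max_in) auto
  then show "cls v < n" "same_type G (cls v) v" by auto
qed

lemma cls_cong: "same_type G u v \<Longrightarrow> cls u = cls v"
  unfolding cls_def by (metis same_type_sym same_type_trans)

lemma cls_cls [simp]: "v < n \<Longrightarrow> cls (cls v) = cls v"
  using cls_cong[OF cls(2)] .

definition reps :: "nat set" where
  "reps = {v. v < n \<and> cls v = v}"

lemma finite_reps [simp]: "finite reps"
  by (simp add: reps_def)

text \<open>Two representatives in the same part of a partition into types would have the same type
  and so coincide. This ties the number of types that the machine counts to the parameter.\<close>

lemma card_reps_le: "card reps \<le> neighborhood_diversity G"
proof -
  obtain P where P: "partition_on {..<n} P" "card P \<le> neighborhood_diversity G"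
    and same: "\<And>A u v. A \<in> P \<Longrightarrow> u \<in> A \<Longrightarrow> v \<in> A \<Longrightarrow> same_type G u v"
    using nd_at_most_neighborhood_diversity[of G] unfolding nd_at_most_def verts by blast
  have "finite P" using P(1) by (rule finite_elements[rotated]) simp
  have "\<forall>v\<in>reps. \<exists>A\<in>P. v \<in> A"
    using partition_onD1[OF P(1)] by (auto simp: reps_def)
  then obtain part where part: "\<And>v. v \<in> reps \<Longrightarrow> part v \<in> P \<and> v \<in> part v" by metis
  have "inj_on part reps"
  proof
    fix u v assume uv: "u \<in> reps" "v \<in> reps" "part u = part v"
    then have "same_type G u v" using same part by metis
    then have "cls u = cls v" by (rule cls_cong)
    with uv show "u = v" by (simp add: reps_def)
  qed
  then have "card reps \<le> card P"
    using part \<open>finite P\<close> by (intro card_inj_on_le[of part]) auto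
  with P(2) show ?thesis by simp
qed

text \<open>Endpoints are excluded because only for the other vertices does monitoring a terminal
  pair depend on the type alone, by \<open>monitors_same_type\<close>.\<close>

definition token :: "nat \<Rightarrow> nat \<Rightarrow> nat \<Rightarrow> bool" where
  "token w u v \<longleftrightarrow> w \<noteq> u \<and> w \<noteq> v \<and> monitors w u v"

definition solution :: "nat set \<Rightarrow> bool" where
  "solution S \<longleftrightarrow> S \<subseteq> {..<n} \<and> card S \<le> k \<and>
     (\<forall>u v. {u, v} \<in> Tp \<longrightarrow> (\<exists>w\<in>S. monitors w u v))"

definition token_step :: "nat \<Rightarrow> nat \<times> nat set \<Rightarrow> nat \<times> nat set" where
  "token_step v = (\<lambda>(z, X).
     if cls v = v then (z div 2, if odd z then insert v X else X) else (z, X))"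

text \<open>A digit is consumed exactly when \<open>S\<close> grows. Every pair is met in both
  orientations; once an endpoint is chosen, the second visit changes nothing.\<close>

definition pair_step :: "nat set \<Rightarrow> nat \<times> nat \<Rightarrow> nat \<times> nat set \<Rightarrow> nat \<times> nat set" where
  "pair_step X = (\<lambda>(u, v) (z, S).
     if {u, v} \<in> Tp \<and> u \<notin> S \<and> v \<notin> S \<and> \<not> (\<exists>w\<in>X. token w u v)
     then (z div 2, insert (if odd z then u else v) S) else (z, S))"

definition cost :: "nat set \<Rightarrow> nat set \<Rightarrow> nat" where
  "cost X S = card S + card {r \<in> X. r \<notin> cls ` S}"

text \<open>The pairs that two nested counters have visited when they stand at
  \<open>(u, v)\<close>, in the form that the invariants of \<open>wp_For_For\<close>
  require.\<close>

definition pairs_before :: "nat \<Rightarrow> nat \<Rightarrow> (nat \<times> nat) list" where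
  "pairs_before u v = concat (map (\<lambda>a. map (Pair a) [0..<n]) [0..<u]) @ map (Pair u) [0..<v]"

lemma pairs_before_0 [simp]: "pairs_before 0 0 = []"
  and pairs_before_Suc: "pairs_before u (Suc v) = pairs_before u v @ [(u, v)]"
  and pairs_before_row: "pairs_before u n = pairs_before (Suc u) 0"
  by (simp_all add: pairs_before_def)

lemma set_pairs_before: "set (pairs_before n 0) = {..<n} \<times> {..<n}"
  by (auto simp: pairs_before_def)

section \<open>Accepted guesses yield solutions\<close>

lemma fold_token_step:
  "fold token_step [0..<i] (z, {}) = (z', X) \<Longrightarrow> i \<le> n \<Longrightarrow> X \<subseteq> {v\<in>reps. v < i} \<and> z' \<le> z"
proof (induction i arbitrary: z' X)
  case (Suc i)
  obtain z1 X1 where 1: "fold token_step [0..<i] (z, {}) = (z1, X1)" by fastforce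
  have "token_step i (z1, X1) = (z', X)" using Suc.prems 1 by simp
  with Suc.IH[OF 1] Suc.prems(2) show ?case
    by (auto simp: token_step_def reps_def less_Suc_eq split: if_splits)
qed auto

lemma fold_pair_step:
  assumes "fold (pair_step X) L (z, {}) = (z', S)" "set L \<subseteq> {..<n} \<times> {..<n}"
  shows "S \<subseteq> {..<n} \<and>
    (\<forall>(u, v)\<in>set L. {u, v} \<in> Tp \<longrightarrow> u \<in> S \<or> v \<in> S \<or> (\<exists>w\<in>X. token w u v))"
  using assms
proof (induction L arbitrary: z' S rule: rev_induct)
  case (snoc p L)
  obtain z1 S1 where 1: "fold (pair_step X) L (z, {}) = (z1, S1)" by fastforce
  obtain u v where p: "p = (u, v)" by fastforce
  have uv: "u < n" "v < n" using snoc.prems p by auto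
  have step: "pair_step X (u, v) (z1, S1) = (z', S)" using snoc.prems 1 p by simp
  then have "S1 \<subseteq> S" "S \<subseteq> insert u (insert v S1)"
    "{u, v} \<in> Tp \<Longrightarrow> u \<in> S \<or> v \<in> S \<or> (\<exists>w\<in>X. token w u v)"
    by (auto simp: pair_step_def split: if_splits)
  with snoc.IH[OF 1] snoc.prems(2) uv show ?case
    unfolding p by fastforce
qed auto

text \<open>A token whose type is missed by \<open>S\<close> is added to the solution itself. For
  any other token, some member of \<open>S\<close> has the same type and monitors the same pairs by
  \<open>monitors_same_type\<close>. There is no condition on the size of \<open>z\<close>.\<close>

lemma guess_sound:
  assumes X: "fold token_step [0..<n] (z, {}) = (z1, X)"
    and S: "fold (pair_step X) (pairs_before n 0) (z1, {}) = (z2, S)"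
    and "cost X S \<le> k"
  shows "solution (S \<union> {r \<in> X. r \<notin> cls ` S})"
proof -
  have XR: "X \<subseteq> reps" using fold_token_step[OF X] by auto
  note * = fold_pair_step[OF S]
  have Sn: "S \<subseteq> {..<n}" and
    cov: "\<And>u v. {u, v} \<in> Tp \<Longrightarrow> u \<in> S \<or> v \<in> S \<or> (\<exists>w\<in>X. token w u v)"
    using * pair_verts by (auto simp: set_pairs_before)
  have "card (S \<union> {r \<in> X. r \<notin> cls ` S}) \<le> cost X S"
    unfolding cost_def by (rule card_Un_le)
  moreover have "\<exists>w\<in>S \<union> {r \<in> X. r \<notin> cls ` S}. monitors w u v" if uv: "{u, v} \<in> Tp" for u v
  proof -
    have V: "u \<in> pverts G" "v \<in> pverts G" using pair_verts[OF uv] by (auto simp: verts)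
    from cov[OF uv] show ?thesis
    proof (elim disjE bexE)
      fix w assume w: "w \<in> X" "token w u v"
      show ?thesis
      proof (cases "w \<in> cls ` S")
        case True
        then obtain s where s: "s \<in> S" "w = cls s" by auto
        then have "same_type G w s" "w \<in> pverts G" "s \<in> pverts G"
          using cls Sn by (auto simp: verts)
        with w V monitors_same_type[of w u v s] finite_dist[OF uv] s(1) show ?thesis
          unfolding token_def by blast
      qed (use w in \<open>auto simp: token_def\<close>)
    qed (use monitors_endpoint[OF V] in blast)+
  qed
  ultimately show ?thesis
    using assms(3) Sn XR by (auto simp: solution_def reps_def)
qed

text \<open>
  Completeness: the bits are read off from a given solution and the guess \<open>z\<close> is built from its
  last bit backwards, hence the arbitrary remainder \<open>z'\<close>.
\<close>

lemma guess_tokens: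
  "\<exists>z. fold token_step [0..<i] (z, {}) = (z', {v\<in>Y. v < i \<and> cls v = v}) \<and>
     Suc z \<le> 2 ^ card {v. v < i \<and> cls v = v} * Suc z'"
proof (induction i arbitrary: z')
  case (Suc i)
  show ?case
  proof (cases "cls i = i")
    case True
    \<comment> \<open>Vertex \<open>i\<close> reads the last digit of \<open>z1\<close> and leaves
      \<open>z'\<close>. Counting with successors makes the bound multiplicative, since the
      successor of \<open>2 * z' + 1\<close> is \<open>2 * Suc z'\<close>.\<close>
    define z1 where "z1 = 2 * z' + of_bool (i \<in> Y)"
    obtain z where z: "fold token_step [0..<i] (z, {}) = (z1, {v\<in>Y. v < i \<and> cls v = v})"
      "Suc z \<le> 2 ^ card {v. v < i \<and> cls v = v} * Suc z1" using Suc by blast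
    have "{v. v < Suc i \<and> cls v = v} = insert i {v. v < i \<and> cls v = v}"
      using True by (auto simp: less_Suc_eq)
    then have c: "card {v. v < Suc i \<and> cls v = v} = Suc (card {v. v < i \<and> cls v = v})" by simp
    have "Suc z1 \<le> 2 * Suc z'" by (simp add: z1_def)
    then have "2 ^ card {v. v < i \<and> cls v = v} * Suc z1 \<le> 2 ^ card {v. v < i \<and> cls v = v} * (2 * Suc z')"
      by (rule mult_le_mono2)
    with z(2) have "Suc z \<le> 2 ^ card {v. v < Suc i \<and> cls v = v} * Suc z'"
      unfolding c by (simp add: algebra_simps)
    moreover have "fold token_step [0..<Suc i] (z, {}) = (z', {v\<in>Y. v < Suc i \<and> cls v = v})"
      using z(1) True by (auto simp: token_step_def z1_def less_Suc_eq)
    ultimately show ?thesis by blast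
  next
    case False
    then have "{v\<in>Y. v < Suc i \<and> cls v = v} = {v\<in>Y. v < i \<and> cls v = v}"
      "{v. v < Suc i \<and> cls v = v} = {v. v < i \<and> cls v = v}"
      by (auto simp: less_Suc_eq)
    with Suc False show ?thesis by (auto simp: token_step_def)
  qed
qed auto

text \<open>\<open>T\<close> tells which endpoint to choose, so \<open>S\<close> stays inside
  \<open>T\<close>. The set \<open>S\<close> must not depend on the remainder \<open>z'\<close>: a
  further pair that consumes a digit uses the induction hypothesis with a remainder of about
  \<open>2 * z'\<close>, but with the same \<open>S\<close>.\<close>

lemma guess_pairs:
  assumes T: "finite T"
    and hit: "\<And>u v. (u, v) \<in> set L \<Longrightarrow> {u, v} \<in> Tp \<Longrightarrow> \<not> (\<exists>w\<in>X. token w u v) \<Longrightarrow> u \<in> T \<or> v \<in> T"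
  shows "\<exists>S\<subseteq>T. \<forall>z'. \<exists>z. fold (pair_step X) L (z, {}) = (z', S) \<and> Suc z \<le> 2 ^ card S * Suc z'"
  using hit
proof (induction L rule: rev_induct)
  case Nil
  then show ?case by (intro exI[of _ "{}"]) auto
next
  case (snoc p L)
  then obtain S where S: "S \<subseteq> T"
    "\<And>z'. \<exists>z. fold (pair_step X) L (z, {}) = (z', S) \<and> Suc z \<le> 2 ^ card S * Suc z'"
    by auto
  obtain u v where p: "p = (u, v)" by fastforce
  show ?case
  proof (cases "{u, v} \<in> Tp \<and> u \<notin> S \<and> v \<notin> S \<and> \<not> (\<exists>w\<in>X. token w u v)")
    case True
    then have uv: "u \<in> T \<or> v \<in> T" using snoc.prems p by simp
    define w where "w = (if u \<in> T then u else v)"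
    have w: "w \<in> T" "w \<notin> S" using True uv by (auto simp: w_def)
    have c: "card (insert w S) = Suc (card S)"
      using w(2) S(1) T finite_subset by (metis card_insert_disjoint)
    have "\<exists>z. fold (pair_step X) (L @ [p]) (z, {}) = (z', insert w S) \<and>
        Suc z \<le> 2 ^ card (insert w S) * Suc z'" for z'
    proof -
      define z1 where "z1 = 2 * z' + of_bool (u \<in> T)"
      obtain z where z: "fold (pair_step X) L (z, {}) = (z1, S)" "Suc z \<le> 2 ^ card S * Suc z1"
        using S(2) by blast
      have "Suc z1 \<le> 2 * Suc z'" by (simp add: z1_def)
      then have "2 ^ card S * Suc z1 \<le> 2 ^ card S * (2 * Suc z')" by (rule mult_le_mono2)
      with z(2) have "Suc z \<le> 2 ^ card (insert w S) * Suc z'" 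
        unfolding c by (simp add: algebra_simps)
      moreover have "pair_step X p (z1, S) = (z', insert w S)"
        using True by (simp add: pair_step_def p z1_def w_def)
      then have "fold (pair_step X) (L @ [p]) (z, {}) = (z', insert w S)" using z(1) by simp
      ultimately show ?thesis by blast
    qed
    with S(1) w(1) show ?thesis by (intro exI[of _ "insert w S"]) auto
  next
    case False
    then have "pair_step X p (z, S) = (z, S)" for z by (auto simp: pair_step_def p)
    with S show ?thesis by (intro exI[of _ S]) (auto, metis)
  qed
qed

text \<open>Guess all types that occur in \<open>Y\<close>, even those of vertices that serve as
  endpoints only. Then a pair without a token must be monitored by one of its own endpoints in
  \<open>Y\<close>, so the second stage chooses inside \<open>Y\<close>.\<close>

lemma guess_complete:
  assumes "solution Y"
  obtains z z1 z2 X S where "z < 2 ^ (card reps + k)"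
    "fold token_step [0..<n] (z, {}) = (z1, X)"
    "fold (pair_step X) (pairs_before n 0) (z1, {}) = (z2, S)"
    "cost X S \<le> k"
proof -
  have Y: "Y \<subseteq> {..<n}" "card Y \<le> k" "\<And>u v. {u, v} \<in> Tp \<Longrightarrow> \<exists>w\<in>Y. monitors w u v"
    using assms by (auto simp: solution_def)
  have finY: "finite Y" using Y(1) finite_subset by blast
  define X where "X = cls ` Y"
  have Xn: "X \<subseteq> {v. v < n \<and> cls v = v}" using Y(1) cls by (auto simp: X_def)
  have "u \<in> Y \<or> v \<in> Y" if uv: "{u, v} \<in> Tp" and no: "\<not> (\<exists>w\<in>X. token w u v)" for u v
  proof (rule ccontr)
    assume not: "\<not> (u \<in> Y \<or> v \<in> Y)"
    obtain w where w: "w \<in> Y" "monitors w u v" using Y(3) uv by blast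
    then have "w < n" using Y(1) by auto
    moreover have "w \<noteq> u" "w \<noteq> v" using w(1) not by auto
    ultimately have "token (cls w) u v"
      using monitors_same_type[of w u v "cls w"] w pair_verts[OF uv] finite_dist[OF uv]
        cls[of w] same_type_sym by (auto simp: verts token_def)
    with no w show False by (auto simp: X_def)
  qed
  then obtain S where S: "S \<subseteq> Y" "\<And>z'. \<exists>z. fold (pair_step X) (pairs_before n 0) (z, {}) = (z', S) \<and>
      Suc z \<le> 2 ^ card S * Suc z'"
    using guess_pairs[OF finY, of "pairs_before n 0" X] by blast
  \<comment> \<open>The pairs read the last digits, so they may end with remainder 0; the number
    \<open>z1\<close> they start from is what the token stage has to leave.\<close>
  obtain z1 where z1: "fold (pair_step X) (pairs_before n 0) (z1, {}) = (0, S)"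
    "Suc z1 \<le> 2 ^ card S * Suc 0" using S(2) by blast
  have "{v\<in>X. v < n \<and> cls v = v} = X" using Xn by auto
  then obtain z where z: "fold token_step [0..<n] (z, {}) = (z1, X)"
    "Suc z \<le> 2 ^ card reps * Suc z1"
    using guess_tokens[of n z1 X] unfolding reps_def by auto
  have cS: "card S \<le> card Y" using S(1) finY by (rule card_mono[rotated])
  have "Suc z \<le> 2 ^ card reps * Suc z1" by fact
  also have "\<dots> \<le> 2 ^ card reps * 2 ^ card S" using z1(2) by (intro mult_le_mono2) simp
  also have "\<dots> \<le> 2 ^ (card reps + k)"
    using cS Y(2) by (simp add: power_add)
  finally have "z < 2 ^ (card reps + k)" by simp
  moreover have "cost X S \<le> k"
  proof -
    \<comment> \<open>A guessed type that \<open>S\<close> misses has a vertex in \<open>Y\<close>,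
      necessarily outside \<open>S\<close>; different missed types are paid for by different
      vertices of \<open>Y - S\<close>.\<close>
    have "{r \<in> X. r \<notin> cls ` S} \<subseteq> cls ` (Y - S)" by (auto simp: X_def)
    then have "card {r \<in> X. r \<notin> cls ` S} \<le> card (cls ` (Y - S))"
      using finY by (intro card_mono) auto
    also have "\<dots> \<le> card (Y - S)" using finY by (intro card_image_le) auto
    also have "\<dots> = card Y - card S" using S(1) finY by (intro card_Diff_subset) (auto intro: finite_subset)
    finally show ?thesis using cS Y(2) by (simp add: cost_def)
  qed
  ultimately show thesis using that z z1 by blast
qed

end

section \<open>The program\<close>

abbreviation (input) "row_arr \<equiv> 2 :: nat"
abbreviation (input) "dist_arr \<equiv> 3 :: nat"
abbreviation (input) "cls_arr \<equiv> 4 :: nat"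
abbreviation (input) "tok_arr \<equiv> 5 :: nat"
abbreviation (input) "sol_arr \<equiv> 6 :: nat"
abbreviation (input) "u_var \<equiv> 7 :: nat"
abbreviation (input) "v_var \<equiv> 8 :: nat"
abbreviation (input) "w_var \<equiv> 9 :: nat"
abbreviation (input) "s_var \<equiv> 10 :: nat"
abbreviation (input) "flag_var \<equiv> 11 :: nat"
abbreviation (input) "reps_var \<equiv> 12 :: nat"
abbreviation (input) "range_var \<equiv> 13 :: nat"
abbreviation (input) "guess_var \<equiv> 14 :: nat"
abbreviation (input) "z_var \<equiv> 15 :: nat"
abbreviation (input) "half_var \<equiv> 16 :: nat"
abbreviation (input) "bit_var \<equiv> 17 :: nat"
abbreviation (input) "cost_var \<equiv> 18 :: nat"

definition Order :: exp where "Order = Input (Const 0)"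
definition Bound :: exp where "Bound = Input (Const 1)"

text \<open>Multiples of the number of vertices are looked up in a table for want of multiplication.\<close>

definition Pos :: "exp \<Rightarrow> exp \<Rightarrow> exp" where
  "Pos a b = Add (Arr row_arr a) b"

definition Adj :: "exp \<Rightarrow> exp \<Rightarrow> exp" where
  "Adj a b = Input (Add (Const 2) (Pos a b))"

text \<open>Entry \<open>n\<close> of the row table is \<open>n * n\<close>, the length of the
  adjacency matrix that precedes the matrix of the pairs.\<close>

definition Terminal :: "exp \<Rightarrow> exp \<Rightarrow> exp" where
  "Terminal a b = Input (Add (Const 2) (Add (Arr row_arr Order) (Pos a b)))"

definition Rows :: com where
  "Rows = For u_var Order (Store (At row_arr (Add (Var u_var) (Const 1))) (Add (Arr row_arr (Var u_var)) Order))"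

text \<open>In the distance matrix, 0 stands for infinity and \<open>d + 1\<close> for the distance \<open>d\<close>.\<close>

definition Dist_Init :: com where
  "Dist_Init = For u_var Order (Store (At dist_arr (Pos (Var u_var) (Var u_var))) (Const 1))"

text \<open>One cell of a breadth-first round: an unset cell receives distance \<open>s + 1\<close>
  if some in-neighbor of \<open>v\<close> has distance \<open>s\<close>. The update is done in
  place; a new entry \<open>s + 2\<close> cannot be mistaken for the entry \<open>s + 1\<close> that
  the search looks for.\<close>

definition Layer_Step :: com where
  "Layer_Step =
    Seq (Exists flag_var w_var Order
          (Conj (Same (Arr dist_arr (Pos (Var u_var) (Var w_var))) (Add (Var s_var) (Const 1)))
            (Adj (Var w_var) (Var v_var))))
      (If (Conj (Var flag_var) (Neg (Arr dist_arr (Pos (Var u_var) (Var v_var)))))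
        (Store (At dist_arr (Pos (Var u_var) (Var v_var))) (Add (Var s_var) (Const 2)))
        Skip)"

text \<open>The number of rounds is \<open>n * n\<close>, a bound on the number of arcs that is
  available in the row table.\<close>

definition Distances :: com where
  "Distances =
    Seq Dist_Init (For s_var (Arr row_arr Order) (For u_var Order (For v_var Order Layer_Step)))"

definition Classes_Step :: com where
  "Classes_Step =
    Seq (Exists flag_var w_var Order
          (Conj (Neg (Same (Var w_var) (Var u_var)))
            (Conj (Neg (Same (Var w_var) (Var v_var)))
              (Neg (Same (Adj (Var u_var) (Var w_var)) (Adj (Var v_var) (Var w_var)))))))
      (If (Var flag_var) Skip (Store (At cls_arr (Var v_var)) (Var u_var)))"

definition Classes :: com where
  "Classes = For v_var Order (For u_var Order Classes_Step)"

definition Guess_Range :: com where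
  "Guess_Range =
    Seq (For v_var Order (If (Same (Arr cls_arr (Var v_var)) (Var v_var))
          (Assign reps_var (Add (Var reps_var) (Const 1))) Skip))
    (Seq (Assign range_var (Const 1))
    (Seq (For u_var (Var reps_var) (Assign range_var (Add (Var range_var) (Var range_var))))
      (For u_var Bound (Assign range_var (Add (Var range_var) (Var range_var))))))"

text \<open>The half is found by counting; this linear cost is responsible for the second factor
  \<open>2 ^ (k + t)\<close> in the running time.\<close>

definition Next_Bit :: com where
  "Next_Bit =
    Seq (Assign half_var (Const 0))
    (Seq (While (Sub (Var z_var) (Add (Add (Var half_var) (Var half_var)) (Const 1)))
           (Assign half_var (Add (Var half_var) (Const 1))))
    (Seq (Assign bit_var (Sub (Var z_var) (Add (Var half_var) (Var half_var))))
      (Assign z_var (Var half_var))))"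

text \<open>Both arrays may still hold the previous guess and are cleared on the way.\<close>

definition Token_Step :: com where
  "Token_Step =
    Seq (Store (At sol_arr (Var v_var)) (Const 0))
    (Seq (Store (At tok_arr (Var v_var)) (Const 0))
      (If (Same (Arr cls_arr (Var v_var)) (Var v_var))
        (Seq Next_Bit (Store (At tok_arr (Var v_var)) (Var bit_var))) Skip))"

text \<open>Entries exceed distances by one, so two of them exceed the sum by 2 and the entry of the
  pair lacks 1. Nonzero entries certify that both distances are finite.\<close>

definition Is_Token :: exp where
  "Is_Token =
    Conj (Neg (Same (Var w_var) (Var u_var)))
    (Conj (Neg (Same (Var w_var) (Var v_var)))
    (Conj (Arr dist_arr (Pos (Var u_var) (Var w_var)))
    (Conj (Arr dist_arr (Pos (Var w_var) (Var v_var)))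
      (Same (Add (Arr dist_arr (Pos (Var u_var) (Var w_var))) (Arr dist_arr (Pos (Var w_var) (Var v_var))))
        (Add (Arr dist_arr (Pos (Var u_var) (Var v_var))) (Const 1))))))"

definition Pair_Step :: com where
  "Pair_Step =
    If (Conj (Terminal (Var u_var) (Var v_var))
          (Conj (Neg (Arr sol_arr (Var u_var))) (Neg (Arr sol_arr (Var v_var)))))
      (Seq (Exists flag_var w_var Order (Conj (Arr tok_arr (Var w_var)) Is_Token))
        (If (Var flag_var) Skip
          (Seq Next_Bit
            (If (Var bit_var) (Store (At sol_arr (Var u_var)) (Const 1))
              (Store (At sol_arr (Var v_var)) (Const 1))))))
      Skip"

definition Cost_Step :: com where
  "Cost_Step =
    Seq (Exists flag_var u_var Order
          (Conj (Arr sol_arr (Var u_var)) (Same (Arr cls_arr (Var u_var)) (Var v_var))))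
      (Assign cost_var (Add (Var cost_var)
        (Add (Arr sol_arr (Var v_var)) (Conj (Arr tok_arr (Var v_var)) (Neg (Var flag_var))))))"

text \<open>The output cell is set on success and never reset, so after all guesses it holds their
  disjunction.\<close>

definition Try :: com where
  "Try =
    Seq (Assign z_var (Var guess_var))
    (Seq (For v_var Order Token_Step)
    (Seq (For u_var Order (For v_var Order Pair_Step))
    (Seq (Assign cost_var (Const 0))
    (Seq (For v_var Order Cost_Step)
      (If (Sub (Var cost_var) Bound) Skip (Assign 0 (Const 1)))))))"

definition TMS :: com where
  "TMS = Seq Rows (Seq Distances (Seq Classes (Seq Guess_Range (For guess_var (Var range_var) Try))))"

section \<open>Frames of the parts of the program, and splitting off a binary digit\<close>

lemma writes_Next_Bit [simp]: "{z_var, half_var, bit_var} \<subseteq> W \<Longrightarrow> writes W Next_Bit"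
  by (auto simp: Next_Bit_def)

lemma writes_Layer_Step [simp]: "{w_var, flag_var, dist_arr} \<subseteq> W \<Longrightarrow> writes W Layer_Step"
  by (auto simp: Layer_Step_def)

lemma writes_Classes_Step [simp]: "{w_var, flag_var, cls_arr} \<subseteq> W \<Longrightarrow> writes W Classes_Step"
  by (auto simp: Classes_Step_def)

lemma writes_Token_Step [simp]:
  "{sol_arr, tok_arr, z_var, half_var, bit_var} \<subseteq> W \<Longrightarrow> writes W Token_Step"
  by (auto simp: Token_Step_def)

lemma writes_Pair_Step [simp]:
  "{w_var, flag_var, sol_arr, z_var, half_var, bit_var} \<subseteq> W \<Longrightarrow> writes W Pair_Step"
  by (auto simp: Pair_Step_def)

lemma writes_Cost_Step [simp]: "{u_var, flag_var, cost_var} \<subseteq> W \<Longrightarrow> writes W Cost_Step"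
  by (auto simp: Cost_Step_def)

text \<open>The counter never exceeds \<open>z div 2\<close>, and below that bound the guard fails
  only when it is reached. A round takes two steps, so \<open>2 * z\<close> is a generous bound for
  all rounds.\<close>

lemma wp_Next_Bit:
  "wp xs Next_Bit (\<lambda>t m'. t \<le> 4 + 2 * m (loc z_var 0) \<and>
     m' (loc z_var 0) = m (loc z_var 0) div 2 \<and> m' (loc bit_var 0) = m (loc z_var 0) mod 2 \<and>
     agree_off {z_var, half_var, bit_var} m m') m"
proof -
  define z where "z = m (loc z_var 0)"
  define L where "L = While (Sub (Var z_var) (Add (Add (Var half_var) (Var half_var)) (Const 1)))
           (Assign half_var (Add (Var half_var) (Const 1)))"
  have loop: "wp xs L (\<lambda>t m''. t \<le> 1 + 2 * (z - i) \<and> m'' = m'(loc half_var 0 := z div 2)) m'"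
    if "m' (loc half_var 0) = i" "m' (loc z_var 0) = z" "i \<le> z div 2" for i m'
    using that
  proof (induction "z - i" arbitrary: i m' rule: less_induct)
    case less
    show ?case
    proof (cases "z \<le> 2 * i + 1")
      case True
      then have "i = z div 2" using less.prems(3) by simp
      with True less.prems show ?thesis
        unfolding L_def by (intro wp_While_False) (auto simp: fun_upd_idem)
    next
      case False
      then have "Suc i \<le> z div 2" "z - i = Suc (z - Suc i)" by auto
      then have "wp xs L (\<lambda>t m''. t \<le> 1 + 2 * (z - Suc i) \<and> m'' = m'(loc half_var 0 := z div 2))
          (m'(loc half_var 0 := Suc i))"
        using wp_mono[OF less.hyps[of "Suc i" "m'(loc half_var 0 := Suc i)"]] less.prems by simp
      then have "wp xs L (\<lambda>t m''. 2 + t \<le> 1 + 2 * (z - i) \<and> m'' = m'(loc half_var 0 := z div 2))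
          (m'(loc half_var 0 := Suc i))"
        by (rule wp_mono) (use \<open>z - i = _\<close> in auto)
      with False less.prems show ?thesis
        unfolding L_def by (intro wp_While_True) auto
    qed
  qed
  have "wp xs L (\<lambda>t m'. t \<le> 1 + 2 * (z - 0) \<and> m' = (m(loc half_var 0 := 0))(loc half_var 0 := z div 2))
      (m(loc half_var 0 := 0))"
    by (rule loop) (auto simp: z_def)
  then have "wp xs L (\<lambda>t m'. 1 + (t + (1 + 1)) \<le> 4 + 2 * z \<and> m' = m(loc half_var 0 := z div 2))
      (m(loc half_var 0 := 0))"
    by (rule wp_mono) auto
  moreover have "z - (z div 2 + z div 2) = z mod 2"
    by presburger
  ultimately have "wp xs Next_Bit (\<lambda>t m'. t \<le> 4 + 2 * z \<and>
      m' = m(loc half_var 0 := z div 2, loc bit_var 0 := z mod 2, loc z_var 0 := z div 2)) m"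
    unfolding Next_Bit_def L_def[symmetric]
    by (simp add: z_def) (erule wp_mono, simp)
  then show ?thesis
    by (rule wp_mono) (auto simp: z_def agree_off_upd)
qed

section \<open>Computing the distances\<close>

lemma cell_index_eq_iff:
  fixes n :: nat
  assumes "v < n" "v' < n"
  shows "u * n + v = u' * n + v' \<longleftrightarrow> u = u' \<and> v = v'"
proof
  assume eq: "u * n + v = u' * n + v'"
  from arg_cong[OF eq, of "\<lambda>a. a mod n"] arg_cong[OF eq, of "\<lambda>a. a div n"]
  show "u = u' \<and> v = v'" using assms by simp
qed simp

lemma cell_index_less:
  fixes n :: nat
  assumes "u < n" "v < n"
  shows "u * n + v < n * n"
proof -
  have "u * n + v < Suc u * n" using assms(2) by simp
  also have "\<dots> \<le> n * n" using assms(1) by (intro mult_le_mono1) simp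
  finally show ?thesis .
qed

locale tms_machine = tms_instance G Tp k n for G Tp k n +
  fixes xs :: "nat list"
  assumes input_length: "length xs = 2 + (n * n + n * n)"
    and input_order: "xs ! 0 = n"
    and input_bound: "xs ! 1 = k"
    and input_adj: "\<And>u v. u < n \<Longrightarrow> v < n \<Longrightarrow> xs ! (2 + (u * n + v)) = of_bool ((u, v) \<in> parcs G)"
    and input_pair: "\<And>u v. u < n \<Longrightarrow> v < n \<Longrightarrow>
      xs ! (2 + (n * n + (u * n + v))) = of_bool ({u, v} \<in> Tp)"
begin

definition rows :: "memory \<Rightarrow> bool" where
  "rows m \<longleftrightarrow> (\<forall>u\<le>n. m (loc row_arr u) = u * n)"

lemma rows_agree_off: "rows m \<Longrightarrow> agree_off W m m' \<Longrightarrow> row_arr \<notin> W \<Longrightarrow> rows m'"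
  by (auto simp: rows_def agree_offD)

lemma rows_upd [simp]: "j < 32 \<Longrightarrow> j \<noteq> row_arr \<Longrightarrow> rows (m(loc j i := x)) \<longleftrightarrow> rows m"
  by (simp add: rows_def)

lemma val_Order [simp]: "val xs m Order = n"
  using input_length input_order by (simp add: Order_def)

lemma val_Bound [simp]: "val xs m Bound = k"
  using input_length input_bound by (simp add: Bound_def)

lemma val_Pos [simp]: "rows m \<Longrightarrow> val xs m a \<le> n \<Longrightarrow> val xs m (Pos a b) = val xs m a * n + val xs m b"
  by (simp add: Pos_def rows_def)

lemma val_Adj [simp]:
  "rows m \<Longrightarrow> val xs m a < n \<Longrightarrow> val xs m b < n \<Longrightarrow>
    val xs m (Adj a b) = of_bool ((val xs m a, val xs m b) \<in> parcs G)"
  using cell_index_less[of "val xs m a" n "val xs m b"] input_adj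
  by (simp add: Adj_def input_length)

lemma val_Terminal [simp]:
  "rows m \<Longrightarrow> val xs m a < n \<Longrightarrow> val xs m b < n \<Longrightarrow>
    val xs m (Terminal a b) = of_bool ({val xs m a, val xs m b} \<in> Tp)"
  using cell_index_less[of "val xs m a" n "val xs m b"] input_pair
  by (simp add: Terminal_def input_length) (simp add: rows_def)

lemma wp_Rows:
  assumes "m (loc row_arr 0) = 0"
  shows "wp xs Rows (\<lambda>t m'. t \<le> 2 + n * 3 \<and> rows m' \<and> agree_off {u_var, row_arr} m m') m"
proof -
  have "wp xs Rows (\<lambda>t m'. t \<le> 2 + n * (1 + 2) \<and> (\<forall>u\<le>n. m' (loc row_arr u) = u * n) \<and>
      agree_off (insert u_var {row_arr}) m m') m"
    unfolding Rows_def
  proof (rule wp_For[where Inv = "\<lambda>i m'. \<forall>u\<le>i. m' (loc row_arr u) = u * n"])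
    fix i m'
    assume "\<forall>u\<le>i. m' (loc row_arr u) = u * n" "m' (loc u_var 0) = i"
    then show "wp xs (Store (At row_arr (Add (Var u_var) (Const 1))) (Add (Arr row_arr (Var u_var)) Order))
      (\<lambda>t m''. t \<le> 1 \<and> (\<forall>u\<le>Suc i. (m''(loc u_var 0 := Suc i)) (loc row_arr u) = u * n)) m'"
      by (simp add: le_Suc_eq)
  qed (use assms in auto)
  then show ?thesis by (rule wp_mono) (auto simp: rows_def)
qed

section \<open>Breadth-first layers\<close>

definition layer :: "nat \<Rightarrow> nat \<Rightarrow> nat \<Rightarrow> nat" where
  "layer s u v = (if \<exists>i\<le>s. (u, v) \<in> parcs G ^^ i then Suc (steps u v) else 0)"

lemma layer_0: "layer 0 u v = of_bool (u = v)"
  using steps_le[of u v 0] by (auto simp: layer_def)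

text \<open>From stage \<open>s\<close> on, the entry \<open>Suc s\<close> marks exactly the pairs
  at distance \<open>s\<close>. So it may be read from a partially updated matrix.\<close>

lemma layer_eq_Suc_iff:
  assumes "s \<le> i"
  shows "layer i u w = Suc s \<longleftrightarrow> (u, w) \<in> parcs G ^^ s \<and> steps u w = s"
proof
  assume "layer i u w = Suc s"
  then have "\<exists>j. (u, w) \<in> parcs G ^^ j" "steps u w = s"
    by (auto simp: layer_def split: if_splits)
  then show "(u, w) \<in> parcs G ^^ s \<and> steps u w = s" using relpow_steps by blast
next
  assume "(u, w) \<in> parcs G ^^ s \<and> steps u w = s"
  with assms show "layer i u w = Suc s" unfolding layer_def by presburger
qed

text \<open>The last but one vertex of a walk of length \<open>s + 1\<close> to a vertex not reached
  before has distance exactly \<open>s\<close>; a smaller distance would have reached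
  \<open>v\<close> by round \<open>s\<close>.\<close>

lemma layer_Suc:
  "layer (Suc s) u v =
    (if layer s u v = 0 \<and> (\<exists>w<n. layer s u w = Suc s \<and> (w, v) \<in> parcs G) then s + 2 else layer s u v)"
proof (cases "layer s u v = 0")
  case True
  then have no: "\<And>i. i \<le> s \<Longrightarrow> (u, v) \<notin> parcs G ^^ i" by (auto simp: layer_def split: if_splits)
  have "(u, v) \<in> parcs G ^^ Suc s \<longleftrightarrow> (\<exists>w<n. layer s u w = Suc s \<and> (w, v) \<in> parcs G)"
  proof
    assume "(u, v) \<in> parcs G ^^ Suc s"
    then obtain w where w: "(u, w) \<in> parcs G ^^ s" "(w, v) \<in> parcs G" by auto
    have "steps u w = s"
    proof (rule ccontr)
      assume "steps u w \<noteq> s"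
      then have "Suc (steps u w) \<le> s" using steps_le[OF w(1)] by simp
      moreover have "(u, v) \<in> parcs G ^^ Suc (steps u w)" using relpow_steps[OF w(1)] w(2) by auto
      ultimately show False using no by blast
    qed
    moreover have "w < n" using in_arcsD1[OF w(2)] by (simp add: verts)
    ultimately show "\<exists>w<n. layer s u w = Suc s \<and> (w, v) \<in> parcs G"
      using w by (auto simp: layer_eq_Suc_iff)
  next
    assume "\<exists>w<n. layer s u w = Suc s \<and> (w, v) \<in> parcs G"
    then show "(u, v) \<in> parcs G ^^ Suc s"
      by (auto simp: layer_eq_Suc_iff)
  qed
  moreover have "steps u v = Suc s" if "(u, v) \<in> parcs G ^^ Suc s"
    using steps_le[OF that] relpow_steps[OF that] no by (meson le_antisym not_less_eq_eq)
  moreover have "layer (Suc s) u v = (if (u, v) \<in> parcs G ^^ Suc s then Suc (steps u v) else 0)"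
    using no unfolding layer_def by (metis le_Suc_eq)
  ultimately show ?thesis using True by auto
next
  case False
  then have *: "\<exists>i\<le>s. (u, v) \<in> parcs G ^^ i" unfolding layer_def by presburger
  then have "\<exists>i\<le>Suc s. (u, v) \<in> parcs G ^^ i" using le_SucI by blast
  with * have "layer (Suc s) u v = layer s u v" by (simp add: layer_def)
  with False show ?thesis by simp
qed

text \<open>Whatever can be reached at all can be reached by a walk with at most as many steps as
  there are arcs, hence within \<open>n * n\<close> steps.\<close>

lemma layer_stable:
  "layer (n * n) u v = (if \<exists>i. (u, v) \<in> parcs G ^^ i then Suc (steps u v) else 0)"
proof -
  have "finite (parcs G)" using finite_arcs by simp
  have "parcs G \<subseteq> {..<n} \<times> {..<n}"
  proof
    fix e assume "e \<in> parcs G"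
    then show "e \<in> {..<n} \<times> {..<n}"
      using arc_fst_in_verts[of e] arc_snd_in_verts[of e] by (cases e) (simp add: verts)
  qed
  then have "card (parcs G) \<le> card ({..<n} \<times> {..<n})" by (intro card_mono) auto
  then have card: "card (parcs G) \<le> n * n" by (simp add: card_cartesian_product)
  have "\<exists>j\<le>n * n. (u, v) \<in> parcs G ^^ j" if walk: "(u, v) \<in> parcs G ^^ i" for i
  proof -
    obtain j where "j \<le> card (parcs G)" "(u, v) \<in> parcs G ^^ j"
      using subsetD[OF relpow_finite_bounded[OF \<open>finite (parcs G)\<close>] walk] by (elim UN_E) simp
    with card show ?thesis by (intro exI[of _ j]) simp
  qed
  then have "(\<exists>j\<le>n * n. (u, v) \<in> parcs G ^^ j) \<longleftrightarrow> (\<exists>i. (u, v) \<in> parcs G ^^ i)" by metis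
  then show ?thesis unfolding layer_def by presburger
qed

definition dists :: "(nat \<Rightarrow> nat \<Rightarrow> nat) \<Rightarrow> memory \<Rightarrow> bool" where
  "dists d m \<longleftrightarrow> (\<forall>u<n. \<forall>v<n. m (loc dist_arr (u * n + v)) = d u v)"

lemma dists_agree_off: "dists d m \<Longrightarrow> agree_off W m m' \<Longrightarrow> dist_arr \<notin> W \<Longrightarrow> dists d m'"
  by (auto simp: dists_def agree_offD)

lemma dists_upd [simp]: "j < 32 \<Longrightarrow> j \<noteq> dist_arr \<Longrightarrow> dists d (m(loc j i := x)) \<longleftrightarrow> dists d m"
  by (simp add: dists_def)

lemma dists_cell: "dists d m \<Longrightarrow> u < n \<Longrightarrow> v < n \<Longrightarrow> m (loc dist_arr (u * n + v)) = d u v"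
  by (simp add: dists_def)

lemma dists_store:
  "dists d m \<Longrightarrow> u < n \<Longrightarrow> v < n \<Longrightarrow>
    dists (\<lambda>u' v'. if u' = u \<and> v' = v then x else d u' v') (m(loc dist_arr (u * n + v) := x))"
  by (simp add: dists_def cell_index_eq_iff)

lemma wp_Dist_Init:
  assumes "rows m" "dists (\<lambda>_ _. 0) m"
  shows "wp xs Dist_Init (\<lambda>t m'. t \<le> 2 + n * 3 \<and> dists (layer 0) m' \<and> agree_off {u_var, dist_arr} m m') m"
proof -
  have "wp xs Dist_Init (\<lambda>t m'. t \<le> 2 + n * (1 + 2) \<and> dists (\<lambda>u v. of_bool (u = v \<and> u < n)) m' \<and>
      agree_off (insert u_var {dist_arr}) m m') m"
    unfolding Dist_Init_def
  proof (rule wp_For[where Inv = "\<lambda>i m'. dists (\<lambda>u v. of_bool (u = v \<and> u < i)) m'"])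
    fix i m'
    assume *: "i < n" "dists (\<lambda>u v. of_bool (u = v \<and> u < i)) m'" "m' (loc u_var 0) = i"
      and ag: "agree_off (insert u_var {dist_arr}) m m'"
    have eq: "(\<lambda>u v. if u = i \<and> v = i then 1 else of_bool (u = v \<and> u < i)) =
        (\<lambda>u v. of_bool (u = v \<and> u < Suc i))"
      by (auto simp: fun_eq_iff)
    have "rows m'" using assms(1) ag by (rule rows_agree_off) simp
    moreover have "dists (\<lambda>u v. of_bool (u = v \<and> u < Suc i)) (m'(loc dist_arr (i * n + i) := 1))"
      using dists_store[OF *(2) *(1) *(1), of 1] unfolding eq .
    ultimately show "wp xs (Store (At dist_arr (Pos (Var u_var) (Var u_var))) (Const 1))
      (\<lambda>t m''. t \<le> 1 \<and> dists (\<lambda>u v. of_bool (u = v \<and> u < Suc i)) (m''(loc u_var 0 := Suc i))) m'"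
      using * by simp
  qed (use assms in auto)
  then show ?thesis by (rule wp_mono) (auto simp: dists_def layer_0)
qed

text \<open>The matrix in the middle of a round: the cells before \<open>(i, j)\<close> in row-major
  order have already moved on to stage \<open>s + 1\<close>.\<close>

definition mixed_layer :: "nat \<Rightarrow> nat \<Rightarrow> nat \<Rightarrow> nat \<Rightarrow> nat \<Rightarrow> nat" where
  "mixed_layer s i j u v = (if u < i \<or> u = i \<and> v < j then layer (Suc s) u v else layer s u v)"

lemma wp_Layer_step:
  assumes "rows m" "dists (mixed_layer s i j) m" "i < n" "j < n"
    "m (loc u_var 0) = i" "m (loc v_var 0) = j" "m (loc s_var 0) = s"
  shows "wp xs Layer_Step (\<lambda>t m'. t \<le> 5 + 4 * n \<and> dists (mixed_layer s i (Suc j)) m') m"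
proof -
  define P where "P w \<longleftrightarrow> layer s i w = Suc s \<and> (w, j) \<in> parcs G" for w
  have "wp xs (Exists flag_var w_var Order
             (Conj (Same (Arr dist_arr (Pos (Var u_var) (Var w_var))) (Add (Var s_var) (Const 1)))
               (Adj (Var w_var) (Var v_var))))
      (\<lambda>t m'. t \<le> 3 + 4 * n \<and> m' (loc flag_var 0) = of_bool (\<exists>w<n. P w) \<and> agree_off {w_var, flag_var} m m') m"
  proof (rule wp_Exists)
    fix m' w assume ag: "agree_off {w_var, flag_var} m m'" and w: "m' (loc w_var 0) = w" "w < n"
    have rd: "rows m'" "dists (mixed_layer s i j) m'"
      using assms(1,2) rows_agree_off[OF _ ag] dists_agree_off[OF _ ag] by auto
    \<comment> \<open>The cell may belong to either stage, but both stages agree on which entries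
      equal \<open>Suc s\<close>.\<close>
    have "mixed_layer s i j i w = Suc s \<longleftrightarrow> layer s i w = Suc s"
      by (simp add: mixed_layer_def layer_eq_Suc_iff)
    then show "val xs m' (Conj (Same (Arr dist_arr (Pos (Var u_var) (Var w_var))) (Add (Var s_var) (Const 1)))
               (Adj (Var w_var) (Var v_var))) \<noteq> 0 \<longleftrightarrow> P w"
      using rd w assms(3-) agree_offD[OF ag] by (simp add: dists_cell P_def)
  qed auto
  then show ?thesis
    unfolding Layer_Step_def wp_Seq
  proof (rule wp_mono)
    fix t m' assume *: "t \<le> 3 + 4 * n \<and> m' (loc flag_var 0) = of_bool (\<exists>w<n. P w) \<and>
      agree_off {w_var, flag_var} m m'"
    then have ag: "agree_off {w_var, flag_var} m m'" by simp
    have rd: "rows m'" "dists (mixed_layer s i j) m'"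
      using assms(1,2) rows_agree_off[OF _ ag] dists_agree_off[OF _ ag] by auto
    have same: "mixed_layer s i (Suc j) =
        (\<lambda>u v. if u = i \<and> v = j then layer (Suc s) i j else mixed_layer s i j u v)"
      by (auto simp: mixed_layer_def fun_eq_iff less_Suc_eq)
    have old: "mixed_layer s i j i j = layer s i j" by (simp add: mixed_layer_def)
    have new: "layer (Suc s) i j = (if layer s i j = 0 \<and> (\<exists>w<n. P w) then s + 2 else layer s i j)"
      unfolding P_def by (rule layer_Suc)
    show "wp xs (If (Conj (Var flag_var) (Neg (Arr dist_arr (Pos (Var u_var) (Var v_var)))))
          (Store (At dist_arr (Pos (Var u_var) (Var v_var))) (Add (Var s_var) (Const 2)))
          Skip) (\<lambda>t'. (\<lambda>t m'. t \<le> 5 + 4 * n \<and> dists (mixed_layer s i (Suc j)) m') (t + t')) m'"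
    proof (cases "layer s i j = 0 \<and> (\<exists>w<n. P w)")
      case True
      then have new': "layer (Suc s) i j = s + 2" unfolding new by (rule if_P)
      have "dists (mixed_layer s i (Suc j)) (m'(loc dist_arr (i * n + j) := s + 2))"
        unfolding same new' by (rule dists_store[OF rd(2) assms(3,4)])
      then show ?thesis
        using rd * assms(3-) agree_offD[OF ag] True by (simp add: dists_cell old)
    next
      case False
      have "mixed_layer s i (Suc j) = mixed_layer s i j"
        unfolding same new using False old by (auto simp: fun_eq_iff)
      then show ?thesis
        using rd * assms(3-) agree_offD[OF ag] False by (auto simp: dists_cell old)
    qed
  qed
qed

lemma wp_Distances:
  assumes "rows m" "dists (\<lambda>_ _. 0) m"
  shows "wp xs Distances (\<lambda>t m'.
    t \<le> (2 + n * 3) + (2 + n * n * ((2 + n * ((2 + n * ((5 + 4 * n) + 2)) + 2)) + 2)) \<and>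
    dists (layer (n * n)) m' \<and> agree_off {s_var, u_var, v_var, w_var, flag_var, dist_arr} m m') m"
  unfolding Distances_def wp_Seq
proof (rule wp_mono[OF wp_Dist_Init[OF assms]])
  fix t m1 assume 1: "t \<le> 2 + n * 3 \<and> dists (layer 0) m1 \<and> agree_off {u_var, dist_arr} m m1"
  have rows1: "rows m1" using assms(1) 1 rows_agree_off[of m _ m1] by force
  have "wp xs (For s_var (Arr row_arr Order) (For u_var Order (For v_var Order Layer_Step)))
    (\<lambda>t m'. t \<le> 2 + n * n * ((2 + n * ((2 + n * ((5 + 4 * n) + 2)) + 2)) + 2) \<and>
      dists (layer (n * n)) m' \<and>
      agree_off (insert s_var {u_var, v_var, w_var, flag_var, dist_arr}) m1 m') m1"
  proof (rule wp_For[where Inv = "\<lambda>s. dists (layer s)"])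
    fix m' assume "agree_off (insert s_var {u_var, v_var, w_var, flag_var, dist_arr}) m1 m'"
    with rows1 have "rows m'" by (rule rows_agree_off) simp
    then show "val xs m' (Arr row_arr Order) = n * n" by (simp add: rows_def)
  next
    fix s m2
    assume 2: "dists (layer s) m2" "m2 (loc s_var 0) = s"
      "agree_off (insert s_var {u_var, v_var, w_var, flag_var, dist_arr}) m1 m2"
    have rows2: "rows m2" using rows1 2(3) by (rule rows_agree_off) simp
    have "wp xs (For u_var Order (For v_var Order Layer_Step))
      (\<lambda>t m'. t \<le> 2 + n * ((2 + n * ((5 + 4 * n) + 2)) + 2) \<and> dists (mixed_layer s n 0) m' \<and>
        agree_off (insert u_var (insert v_var {w_var, flag_var, dist_arr})) m2 m') m2"
    proof (rule wp_For_For[where Inv = "\<lambda>i j. dists (mixed_layer s i j)"])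
      show "dists (mixed_layer s 0 0) m2" using 2 by (simp add: dists_def mixed_layer_def)
    next
      fix i m' assume "dists (mixed_layer s i n) m'"
      then show "dists (mixed_layer s (Suc i) 0) m'"
        by (auto simp: dists_def mixed_layer_def less_Suc_eq)
    next
      fix i j m3
      assume 3: "i < n" "j < n" "dists (mixed_layer s i j) m3" "m3 (loc u_var 0) = i" "m3 (loc v_var 0) = j"
        and ag: "agree_off (insert u_var (insert v_var {w_var, flag_var, dist_arr})) m2 m3"
      have "rows m3" using rows2 ag by (rule rows_agree_off) simp
      moreover have "m3 (loc s_var 0) = s" using 2(2) agree_offD[OF ag] by simp
      ultimately show "wp xs Layer_Step (\<lambda>t m'. t \<le> 5 + 4 * n \<and> dists (mixed_layer s i (Suc j)) m') m3"
        using 3 by (intro wp_Layer_step)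
    qed auto
    then show "wp xs (For u_var Order (For v_var Order Layer_Step))
      (\<lambda>t m'. t \<le> 2 + n * ((2 + n * ((5 + 4 * n) + 2)) + 2) \<and>
        dists (layer (Suc s)) (m'(loc s_var 0 := Suc s))) m2"
      by (rule wp_mono) (auto simp: dists_def mixed_layer_def)
  qed (use 1 in auto)
  then show "wp xs (For s_var (Arr row_arr Order) (For u_var Order (For v_var Order Layer_Step)))
    (\<lambda>t' m'. t + t' \<le> (2 + n * 3) + (2 + n * n * ((2 + n * ((2 + n * ((5 + 4 * n) + 2)) + 2)) + 2)) \<and>
      dists (layer (n * n)) m' \<and> agree_off {s_var, u_var, v_var, w_var, flag_var, dist_arr} m m') m1"
  proof (rule wp_mono, elim conjE, intro conjI)
    fix t' m' assume "agree_off (insert s_var {u_var, v_var, w_var, flag_var, dist_arr}) m1 m'"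
    moreover have "agree_off {s_var, u_var, v_var, w_var, flag_var, dist_arr} m m1"
      using 1 by (elim conjE agree_off_mono) simp
    ultimately show "agree_off {s_var, u_var, v_var, w_var, flag_var, dist_arr} m m'"
      by (rule agree_off_trans[rotated])
  qed (use 1 in \<open>simp_all add: add_le_mono\<close>)
qed

text \<open>For a terminal pair \<open>d(u, v)\<close> is finite, so a vertex at infinite distance
  does not monitor it, in accordance with the test for nonzero entries.\<close>

lemma token_iff_layer:
  assumes "u < n" "v < n" "w < n" "{u, v} \<in> Tp"
  defines "d \<equiv> layer (n * n)"
  shows "token w u v \<longleftrightarrow> w \<noteq> u \<and> w \<noteq> v \<and> d u w \<noteq> 0 \<and> d w v \<noteq> 0 \<and> d u w + d w v = Suc (d u v)"
proof -
  have V: "u \<in> pverts G" "w \<in> pverts G" using assms by (auto simp: verts)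
  obtain i where uv: "(u, v) \<in> parcs G ^^ i"
    using finite_dist[OF assms(4)] gdist_less_infinity_iff[OF V(1)] by blast
  show ?thesis
  proof (cases "(\<exists>i. (u, w) \<in> parcs G ^^ i) \<and> (\<exists>i. (w, v) \<in> parcs G ^^ i)")
    case True
    then obtain i' j where uw: "(u, w) \<in> parcs G ^^ i'" and wv: "(w, v) \<in> parcs G ^^ j" by blast
    have "d u w = Suc (steps u w)" "d w v = Suc (steps w v)" "d u v = Suc (steps u v)"
      unfolding d_def layer_stable using uw wv uv by auto
    then show ?thesis
      unfolding token_def monitors_def gdist_eq_steps[OF V(1) uw] gdist_eq_steps[OF V(2) wv]
        gdist_eq_steps[OF V(1) uv] by auto
  next
    case False
    then have "gdist G u w = \<infinity> \<or> gdist G w v = \<infinity>" "d u w = 0 \<or> d w v = 0"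
      unfolding d_def layer_stable using gdist_eq_infinity V by auto
    then show ?thesis
      unfolding token_def monitors_def gdist_eq_steps[OF V(1) uv]
      using gdist_nonneg[OF V(1), of w] gdist_nonneg[OF V(2), of v] by auto
  qed
qed

end

section \<open>Computing the types\<close>

context tms_machine
begin

definition partial_cls :: "nat \<Rightarrow> nat \<Rightarrow> nat \<Rightarrow> bool" where
  "partial_cls v j c \<longleftrightarrow> (\<forall>u<j. same_type G u v \<longrightarrow> u \<le> c) \<and> (c = 0 \<or> c < j \<and> same_type G c v)"

lemma partial_cls_Suc:
  "partial_cls v j c \<Longrightarrow> partial_cls v (Suc j) (if same_type G j v then j else c)"
  by (auto simp: partial_cls_def less_Suc_eq)

lemma partial_cls_complete:
  assumes "partial_cls v n c" "v < n"
  shows "c = cls v"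
proof -
  have "v \<le> c" using assms by (simp add: partial_cls_def)
  then have "c < n" "same_type G c v" using assms by (auto simp: partial_cls_def)
  then show ?thesis
    unfolding cls_def using assms(1) by (intro Max_eqI[symmetric]) (auto simp: partial_cls_def)
qed

definition classes_upto :: "nat \<Rightarrow> nat \<Rightarrow> memory \<Rightarrow> bool" where
  "classes_upto i j m \<longleftrightarrow> (\<forall>v<n. if v < i then m (loc cls_arr v) = cls v
     else if v = i then partial_cls v j (m (loc cls_arr v)) else m (loc cls_arr v) = 0)"

definition classes :: "memory \<Rightarrow> bool" where
  "classes m \<longleftrightarrow> (\<forall>v<n. m (loc cls_arr v) = cls v)"

lemma classes_agree_off: "classes m \<Longrightarrow> agree_off W m m' \<Longrightarrow> cls_arr \<notin> W \<Longrightarrow> classes m'"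
  by (auto simp: classes_def agree_offD)

lemma wp_Classes_Step:
  assumes "rows m" "classes_upto i j m" "i < n" "j < n" "m (loc v_var 0) = i" "m (loc u_var 0) = j"
  shows "wp xs Classes_Step (\<lambda>t m'. t \<le> 5 + 4 * n \<and> classes_upto i (Suc j) m') m"
  unfolding Classes_Step_def wp_Seq
proof (rule wp_mono, rule wp_Exists)
  fix m' w
  assume ag: "agree_off {w_var, flag_var} m m'" and w: "m' (loc w_var 0) = w" "w < n"
  have "rows m'" using assms(1) ag by (rule rows_agree_off) simp
  then show "val xs m' (Conj (Neg (Same (Var w_var) (Var u_var)))
            (Conj (Neg (Same (Var w_var) (Var v_var)))
              (Neg (Same (Adj (Var u_var) (Var w_var)) (Adj (Var v_var) (Var w_var)))))) \<noteq> 0 \<longleftrightarrow>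
      w \<noteq> j \<and> w \<noteq> i \<and> ((j, w) \<in> parcs G) \<noteq> ((i, w) \<in> parcs G)"
    using w assms agree_offD[OF ag] by simp
next
  fix t m'
  assume *: "t \<le> 3 + 4 * n \<and>
    m' (loc flag_var 0) = of_bool (\<exists>w<n. w \<noteq> j \<and> w \<noteq> i \<and> ((j, w) \<in> parcs G) \<noteq> ((i, w) \<in> parcs G)) \<and>
    agree_off {w_var, flag_var} m m'"
  \<comment> \<open>Arcs end in vertices, so a vertex that separates the two neighborhoods can be
    sought below \<open>n\<close>.\<close>
  have "same_type G j i \<longleftrightarrow> \<not> (\<exists>w<n. w \<noteq> j \<and> w \<noteq> i \<and> ((j, w) \<in> parcs G) \<noteq> ((i, w) \<in> parcs G))"
    unfolding same_type_iff using in_arcsD2 verts by (metis lessThan_iff)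
  with * have flag: "m' (loc flag_var 0) = of_bool (\<not> same_type G j i)" by simp
  have ag: "agree_off {w_var, flag_var} m m'" using * by simp
  have "classes_upto i (Suc j) (m'(loc cls_arr i := (if same_type G j i then j else m (loc cls_arr i))))"
    using assms(2) partial_cls_Suc[of i j "m (loc cls_arr i)"] assms(3) agree_offD[OF ag]
    by (auto simp: classes_upto_def)
  then show "wp xs (If (Var flag_var) Skip (Store (At cls_arr (Var v_var)) (Var u_var)))
     (\<lambda>t' m''. t + t' \<le> 5 + 4 * n \<and> classes_upto i (Suc j) m'') m'"
    using flag * assms(5,6) agree_offD[OF ag]
    by (auto simp: fun_upd_idem split: if_splits)
qed auto

lemma wp_Classes:
  assumes "rows m" "\<And>v. v < n \<Longrightarrow> m (loc cls_arr v) = 0"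
  shows "wp xs Classes (\<lambda>t m'. t \<le> 2 + n * ((2 + n * ((5 + 4 * n) + 2)) + 2) \<and> classes m' \<and>
    agree_off {v_var, u_var, w_var, flag_var, cls_arr} m m') m"
proof -
  have "wp xs Classes (\<lambda>t m'. t \<le> 2 + n * ((2 + n * ((5 + 4 * n) + 2)) + 2) \<and> classes_upto n 0 m' \<and>
    agree_off (insert v_var (insert u_var {w_var, flag_var, cls_arr})) m m') m"
    unfolding Classes_def
  proof (rule wp_For_For[where Inv = classes_upto])
    show "classes_upto 0 0 m" using assms by (simp add: classes_upto_def partial_cls_def)
  next
    fix i m' assume "classes_upto i n m'"
    then show "classes_upto (Suc i) 0 m'"
      using partial_cls_complete by (auto simp: classes_upto_def less_Suc_eq partial_cls_def)
  next
    fix i j m' assume *: "i < n" "j < n" "classes_upto i j m'" "m' (loc v_var 0) = i" "m' (loc u_var 0) = j"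
      and ag: "agree_off (insert v_var (insert u_var {w_var, flag_var, cls_arr})) m m'"
    have "rows m'" using assms(1) ag by (rule rows_agree_off) simp
    with * show "wp xs Classes_Step (\<lambda>t m'. t \<le> 5 + 4 * n \<and> classes_upto i (Suc j) m') m'"
      by (intro wp_Classes_Step)
  qed (auto simp: classes_upto_def)
  then show ?thesis by (rule wp_mono) (auto simp: classes_upto_def classes_def)
qed

section \<open>The number of guesses\<close>

lemma wp_Double:
  assumes "\<And>m'. agree_off {u_var, range_var} m m' \<Longrightarrow> val xs m' e = N" "m (loc range_var 0) = a"
  shows "wp xs (For u_var e (Assign range_var (Add (Var range_var) (Var range_var))))
    (\<lambda>t m'. t \<le> 2 + N * 3 \<and> m' (loc range_var 0) = a * 2 ^ N \<and> agree_off {u_var, range_var} m m') m"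
proof -
  have "wp xs (For u_var e (Assign range_var (Add (Var range_var) (Var range_var))))
    (\<lambda>t m'. t \<le> 2 + N * (1 + 2) \<and> m' (loc range_var 0) = a * 2 ^ N \<and>
      agree_off (insert u_var {range_var}) m m') m"
    by (rule wp_For[where Inv = "\<lambda>i m'. m' (loc range_var 0) = a * 2 ^ i"])
      (use assms in auto)
  then show ?thesis by (rule wp_mono) auto
qed

lemma wp_Guess_Range:
  assumes "classes m" "m (loc reps_var 0) = 0"
  shows "wp xs Guess_Range (\<lambda>t m'. t \<le> 7 + 4 * n + 3 * (card reps + k) \<and>
    m' (loc range_var 0) = 2 ^ (card reps + k) \<and> agree_off {v_var, reps_var, range_var, u_var} m m') m"
proof -
  have "wp xs (For v_var Order (If (Same (Arr cls_arr (Var v_var)) (Var v_var))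
          (Assign reps_var (Add (Var reps_var) (Const 1))) Skip))
    (\<lambda>t m'. t \<le> 2 + n * (2 + 2) \<and> m' (loc reps_var 0) = card {v. v < n \<and> cls v = v} \<and>
      agree_off (insert v_var {reps_var}) m m') m"
  proof (rule wp_For[where Inv = "\<lambda>i m'. m' (loc reps_var 0) = card {v. v < i \<and> cls v = v}"])
    fix i m'
    assume *: "i < n" "m' (loc reps_var 0) = card {v. v < i \<and> cls v = v}" "m' (loc v_var 0) = i"
      and ag: "agree_off (insert v_var {reps_var}) m m'"
    have "classes m'" using assms(1) ag by (rule classes_agree_off) simp
    then have c: "m' (loc cls_arr i) = cls i" using *(1) by (simp add: classes_def)
    have "{v. v < Suc i \<and> cls v = v} =
        (if cls i = i then insert i {v. v < i \<and> cls v = v} else {v. v < i \<and> cls v = v})"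
      by (auto simp: less_Suc_eq)
    then have "card {v. v < Suc i \<and> cls v = v} =
        (if cls i = i then Suc (card {v. v < i \<and> cls v = v}) else card {v. v < i \<and> cls v = v})"
      by simp
    then show "wp xs (If (Same (Arr cls_arr (Var v_var)) (Var v_var))
          (Assign reps_var (Add (Var reps_var) (Const 1))) Skip)
        (\<lambda>t m''. t \<le> 2 \<and> (m''(loc v_var 0 := Suc i)) (loc reps_var 0) = card {v. v < Suc i \<and> cls v = v}) m'"
      using * c by simp
  qed (use assms in auto)
  then show ?thesis
    unfolding Guess_Range_def wp_Seq
  proof (rule wp_mono)
    fix t1 m1
    assume 1: "t1 \<le> 2 + n * (2 + 2) \<and> m1 (loc reps_var 0) = card {v. v < n \<and> cls v = v} \<and>
      agree_off (insert v_var {reps_var}) m m1"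
    define m2 where "m2 = m1(loc range_var 0 := 1)"
    have r: "m2 (loc reps_var 0) = card reps" using 1 by (simp add: m2_def reps_def)
    have ag2: "agree_off {v_var, reps_var, range_var, u_var} m m2"
      unfolding m2_def by (rule agree_off_upd[OF _ _ agree_off_mono[of "insert v_var {reps_var}"]]) (use 1 in auto)
    have "wp xs (For u_var (Var reps_var) (Assign range_var (Add (Var range_var) (Var range_var))))
      (\<lambda>t m'. t \<le> 2 + card reps * 3 \<and> m' (loc range_var 0) = 1 * 2 ^ card reps \<and>
        agree_off {u_var, range_var} m2 m') m2"
      by (rule wp_Double) (use r in \<open>auto simp: agree_offD m2_def\<close>)
    then have "wp xs (For u_var (Var reps_var) (Assign range_var (Add (Var range_var) (Var range_var))))
      (\<lambda>t2. wp xs (For u_var Bound (Assign range_var (Add (Var range_var) (Var range_var))))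
        (\<lambda>t3 m'. t1 + (1 + (t2 + t3)) \<le> 7 + 4 * n + 3 * (card reps + k) \<and>
          m' (loc range_var 0) = 2 ^ (card reps + k) \<and>
          agree_off {v_var, reps_var, range_var, u_var} m m')) m2"
    proof (rule wp_mono)
      fix t2 m3 assume 3: "t2 \<le> 2 + card reps * 3 \<and> m3 (loc range_var 0) = 1 * 2 ^ card reps \<and>
        agree_off {u_var, range_var} m2 m3"
      have ag3: "agree_off {v_var, reps_var, range_var, u_var} m m3"
        by (rule agree_off_trans[OF ag2 agree_off_mono[of "{u_var, range_var}"]]) (use 3 in auto)
      show "wp xs (For u_var Bound (Assign range_var (Add (Var range_var) (Var range_var))))
        (\<lambda>t3 m'. t1 + (1 + (t2 + t3)) \<le> 7 + 4 * n + 3 * (card reps + k) \<and>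
          m' (loc range_var 0) = 2 ^ (card reps + k) \<and>
          agree_off {v_var, reps_var, range_var, u_var} m m') m3"
      proof (rule wp_mono[OF wp_Double[where N = k]])
        fix t m' assume 4: "t \<le> 2 + k * 3 \<and> m' (loc range_var 0) = m3 (loc range_var 0) * 2 ^ k \<and>
          agree_off {u_var, range_var} m3 m'"
        have "agree_off {v_var, reps_var, range_var, u_var} m m'"
          by (rule agree_off_trans[OF ag3 agree_off_mono[of "{u_var, range_var}"]]) (use 4 in auto)
        with 1 3 4 show "t1 + (1 + (t2 + t)) \<le> 7 + 4 * n + 3 * (card reps + k) \<and>
          m' (loc range_var 0) = 2 ^ (card reps + k) \<and>
          agree_off {v_var, reps_var, range_var, u_var} m m'"
          by (auto simp: power_add)
      qed auto
    qed
    then show "wp xs (Assign range_var (Const 1))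
      (\<lambda>t. wp xs (For u_var (Var reps_var) (Assign range_var (Add (Var range_var) (Var range_var))))
        (\<lambda>t'. wp xs (For u_var Bound (Assign range_var (Add (Var range_var) (Var range_var))))
          (\<lambda>t''. (\<lambda>t''a m'. t1 + t''a \<le> 7 + 4 * n + 3 * (card reps + k) \<and>
            m' (loc range_var 0) = 2 ^ (card reps + k) \<and>
            agree_off {v_var, reps_var, range_var, u_var} m m') (t + (t' + t''))))) m1"
      by (simp add: m2_def)
  qed
qed

end

section \<open>Evaluating a guess\<close>

context tms_machine
begin

definition members :: "nat \<Rightarrow> nat set \<Rightarrow> memory \<Rightarrow> bool" where
  "members a X m \<longleftrightarrow> (\<forall>v<n. m (loc a v) = of_bool (v \<in> X))"

lemma members_agree_off: "members a X m \<Longrightarrow> agree_off W m m' \<Longrightarrow> a \<notin> W \<Longrightarrow> a < 32 \<Longrightarrow> members a X m'"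
  by (auto simp: members_def agree_offD)

lemma members_upd [simp]:
  "j < 32 \<Longrightarrow> a < 32 \<Longrightarrow> j \<noteq> a \<Longrightarrow> members a X (m(loc j i := x)) \<longleftrightarrow> members a X m"
  by (simp add: members_def)

lemma members_insert: "members a X m \<Longrightarrow> a < 32 \<Longrightarrow> members a (insert v X) (m(loc a v := 1))"
  by (auto simp: members_def)

lemma members_cell: "members a X m \<Longrightarrow> v < n \<Longrightarrow> m (loc a v) = of_bool (v \<in> X)"
  by (simp add: members_def)

text \<open>Only entries below \<open>i\<close> are described, because the others may stem from the
  previous guess.\<close>

definition token_state :: "nat \<Rightarrow> nat \<times> nat set \<Rightarrow> memory \<Rightarrow> bool" where
  "token_state i p m \<longleftrightarrow> m (loc z_var 0) = fst p \<and>
     (\<forall>v<i. m (loc tok_arr v) = of_bool (v \<in> snd p) \<and> m (loc sol_arr v) = 0)"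

text \<open>Two clearing stores, a guard, at most \<open>4 + 2 * B\<close> steps for the digit and
  the final store.\<close>

lemma wp_Token_Step:
  assumes "classes m" "token_state i (z, X) m" "X \<subseteq> {..<i}" "i < n" "m (loc v_var 0) = i" "z \<le> B"
  shows "wp xs Token_Step (\<lambda>t m'. t \<le> 8 + 2 * B \<and> token_state (Suc i) (token_step i (z, X)) m') m"
proof -
  define m1 where "m1 = m(loc sol_arr i := 0, loc tok_arr i := 0)"
  have m1: "m1 (loc v_var 0) = i" "m1 (loc cls_arr i) = cls i" "m1 (loc z_var 0) = z"
    using assms by (simp_all add: m1_def classes_def token_state_def)
  have low: "\<And>v. v < i \<Longrightarrow> m1 (loc tok_arr v) = of_bool (v \<in> X) \<and> m1 (loc sol_arr v) = 0"
    "m1 (loc sol_arr i) = 0" "m1 (loc tok_arr i) = 0"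
    using assms(2) by (simp_all add: m1_def token_state_def)
  have "i \<notin> X" using assms(3) by auto
  have "wp xs (If (Same (Arr cls_arr (Var v_var)) (Var v_var))
        (Seq Next_Bit (Store (At tok_arr (Var v_var)) (Var bit_var))) Skip)
      (\<lambda>t m'. 2 + t \<le> 8 + 2 * B \<and> token_state (Suc i) (token_step i (z, X)) m') m1"
  proof (cases "cls i = i")
    case True
    have "wp xs Next_Bit (\<lambda>t m'. wp xs (Store (At tok_arr (Var v_var)) (Var bit_var))
      (\<lambda>t' m'. 2 + (1 + (t + t')) \<le> 8 + 2 * B \<and> token_state (Suc i) (token_step i (z, X)) m') m') m1"
    proof (rule wp_mono[OF wp_Next_Bit])
      fix t m' assume *: "t \<le> 4 + 2 * m1 (loc z_var 0) \<and> m' (loc z_var 0) = m1 (loc z_var 0) div 2 \<and>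
        m' (loc bit_var 0) = m1 (loc z_var 0) mod 2 \<and> agree_off {z_var, half_var, bit_var} m1 m'"
      then have ag: "agree_off {z_var, half_var, bit_var} m1 m'" by simp
      have "m' (loc v_var 0) = i" using m1 agree_offD[OF ag] by simp
      then show "wp xs (Store (At tok_arr (Var v_var)) (Var bit_var))
        (\<lambda>t' m'. 2 + (1 + (t + t')) \<le> 8 + 2 * B \<and> token_state (Suc i) (token_step i (z, X)) m') m'"
        using * True low agree_offD[OF ag] m1 assms(6) \<open>i \<notin> X\<close>
        by (auto simp: token_state_def token_step_def less_Suc_eq odd_iff_mod_2_eq_one)
    qed
    moreover have "val xs m1 (Same (Arr cls_arr (Var v_var)) (Var v_var)) \<noteq> 0" using True m1 by simp
    ultimately show ?thesis by (simp only: wp_If wp_Seq if_True not_False_eq_True)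
  next
    case False
    then show ?thesis
      using m1 low \<open>i \<notin> X\<close> by (simp add: token_state_def token_step_def less_Suc_eq)
  qed
  then show ?thesis
    unfolding Token_Step_def using assms(5) by (simp add: m1_def)
qed

lemma wp_Tokens:
  assumes "classes m" "m (loc z_var 0) = z"
  shows "wp xs (For v_var Order Token_Step) (\<lambda>t m'. t \<le> 2 + n * ((8 + 2 * z) + 2) \<and>
    token_state n (fold token_step [0..<n] (z, {})) m' \<and>
    agree_off (insert v_var {sol_arr, tok_arr, z_var, half_var, bit_var}) m m') m"
proof (rule wp_For[where Inv = "\<lambda>i. token_state i (fold token_step [0..<i] (z, {}))"])
  show "token_state 0 (fold token_step [0..<0] (z, {})) (m(loc v_var 0 := 0))"
    using assms(2) by (simp add: token_state_def)
next
  fix i m' assume *: "i < n" "token_state i (fold token_step [0..<i] (z, {})) m'" "m' (loc v_var 0) = i"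
    and ag: "agree_off (insert v_var {sol_arr, tok_arr, z_var, half_var, bit_var}) m m'"
  have "classes m'" using assms(1) ag by (rule classes_agree_off) simp
  obtain z1 X where 1: "fold token_step [0..<i] (z, {}) = (z1, X)" by fastforce
  from fold_token_step[OF 1] *(1) have "X \<subseteq> {..<i}" "z1 \<le> z" by auto
  with * 1 \<open>classes m'\<close>
  have "wp xs Token_Step (\<lambda>t m''. t \<le> 8 + 2 * z \<and> token_state (Suc i) (token_step i (z1, X)) m'') m'"
    by (intro wp_Token_Step) auto
  then show "wp xs Token_Step (\<lambda>t m''. t \<le> 8 + 2 * z \<and>
      token_state (Suc i) (fold token_step [0..<Suc i] (z, {})) (m''(loc v_var 0 := Suc i))) m'"
    by (rule wp_mono) (simp add: 1, simp add: token_state_def)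
qed auto

definition pair_state :: "nat \<times> nat set \<Rightarrow> memory \<Rightarrow> bool" where
  "pair_state p m \<longleftrightarrow> m (loc z_var 0) = fst p \<and> members sol_arr (snd p) m"

lemma val_Is_Token:
  assumes "rows m" "dists (layer (n * n)) m" "m (loc u_var 0) = u" "m (loc v_var 0) = v" "m (loc w_var 0) = w"
    and "u < n" "v < n" "w < n" "{u, v} \<in> Tp"
  shows "val xs m Is_Token = of_bool (token w u v)"
  using assms by (simp add: Is_Token_def dists_cell token_iff_layer)

text \<open>The time consists of three guards, one store, \<open>3 + 4 * n\<close> steps for the
  search and at most \<open>4 + 2 * B\<close> for the digit.\<close>

lemma wp_Pair_Step:
  assumes "rows m" "dists (layer (n * n)) m" "members tok_arr X m" "X \<subseteq> {..<n}"
    and "pair_state (z, S) m" "i < n" "j < n" "m (loc u_var 0) = i" "m (loc v_var 0) = j" "z \<le> B"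
  shows "wp xs Pair_Step (\<lambda>t m'. t \<le> 11 + 4 * n + 2 * B \<and> pair_state (pair_step X (i, j) (z, S)) m') m"
proof (cases "{i, j} \<in> Tp \<and> i \<notin> S \<and> j \<notin> S")
  case False
  then show ?thesis
    using assms by (auto simp: Pair_Step_def pair_step_def pair_state_def members_cell)
next
  case True
  define P where "P \<longleftrightarrow> (\<exists>w\<in>X. token w i j)"
  have "wp xs (Exists flag_var w_var Order (Conj (Arr tok_arr (Var w_var)) Is_Token))
    (\<lambda>t m'. t \<le> 3 + 4 * n \<and> m' (loc flag_var 0) = of_bool (\<exists>w<n. w \<in> X \<and> token w i j) \<and>
      agree_off {w_var, flag_var} m m') m"
  proof (rule wp_Exists)
    fix m' w assume ag: "agree_off {w_var, flag_var} m m'" and w: "m' (loc w_var 0) = w" "w < n"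
    have "rows m'" "dists (layer (n * n)) m'" "members tok_arr X m'"
      using assms(1-3) rows_agree_off[OF _ ag] dists_agree_off[OF _ ag] members_agree_off[OF _ ag] by auto
    then show "val xs m' (Conj (Arr tok_arr (Var w_var)) Is_Token) \<noteq> 0 \<longleftrightarrow> w \<in> X \<and> token w i j"
      using w True assms(6-9) agree_offD[OF ag] by (simp add: val_Is_Token members_cell)
  qed auto
  moreover have "(\<exists>w<n. w \<in> X \<and> token w i j) \<longleftrightarrow> P" using assms(4) by (auto simp: P_def)
  ultimately have ex: "wp xs (Exists flag_var w_var Order (Conj (Arr tok_arr (Var w_var)) Is_Token))
    (\<lambda>t m'. t \<le> 3 + 4 * n \<and> m' (loc flag_var 0) = of_bool P \<and> agree_off {w_var, flag_var} m m') m"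
    by simp
  have "wp xs (Exists flag_var w_var Order (Conj (Arr tok_arr (Var w_var)) Is_Token))
    (\<lambda>t. wp xs (If (Var flag_var) Skip
          (Seq Next_Bit
            (If (Var bit_var) (Store (At sol_arr (Var u_var)) (Const 1))
              (Store (At sol_arr (Var v_var)) (Const 1)))))
      (\<lambda>t' m'. 1 + (t + t') \<le> 11 + 4 * n + 2 * B \<and> pair_state (pair_step X (i, j) (z, S)) m')) m"
    using ex
  proof (rule wp_mono)
    fix t m1 assume 1: "t \<le> 3 + 4 * n \<and> m1 (loc flag_var 0) = of_bool P \<and> agree_off {w_var, flag_var} m m1"
    then have ag: "agree_off {w_var, flag_var} m m1" by simp
    have st: "m1 (loc z_var 0) = z" "members sol_arr S m1" "m1 (loc u_var 0) = i" "m1 (loc v_var 0) = j"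
      using assms(5,8,9) agree_offD[OF ag] members_agree_off[OF _ ag] by (auto simp: pair_state_def)
    show "wp xs (If (Var flag_var) Skip
          (Seq Next_Bit
            (If (Var bit_var) (Store (At sol_arr (Var u_var)) (Const 1))
              (Store (At sol_arr (Var v_var)) (Const 1)))))
      (\<lambda>t' m'. 1 + (t + t') \<le> 11 + 4 * n + 2 * B \<and> pair_state (pair_step X (i, j) (z, S)) m') m1"
    proof (cases P)
      case True
      then have "pair_step X (i, j) (z, S) = (z, S)" by (auto simp: pair_step_def P_def)
      with True 1 st show ?thesis by (simp add: pair_state_def)
    next
      case False
      then have step: "pair_step X (i, j) (z, S) = (z div 2, insert (if odd z then i else j) S)"
        using \<open>{i, j} \<in> Tp \<and> _\<close> unfolding pair_step_def P_def by simp
      have "wp xs Next_Bit (\<lambda>t1. wp xs (If (Var bit_var) (Store (At sol_arr (Var u_var)) (Const 1))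
              (Store (At sol_arr (Var v_var)) (Const 1)))
        (\<lambda>t2 m'. 1 + (t + (1 + (t1 + t2))) \<le> 11 + 4 * n + 2 * B \<and>
          pair_state (pair_step X (i, j) (z, S)) m')) m1"
      proof (rule wp_mono[OF wp_Next_Bit])
        fix t1 m2 assume 2: "t1 \<le> 4 + 2 * m1 (loc z_var 0) \<and> m2 (loc z_var 0) = m1 (loc z_var 0) div 2 \<and>
          m2 (loc bit_var 0) = m1 (loc z_var 0) mod 2 \<and> agree_off {z_var, half_var, bit_var} m1 m2"
        then have ag2: "agree_off {z_var, half_var, bit_var} m1 m2" by simp
        have st2: "members sol_arr S m2" "m2 (loc u_var 0) = i" "m2 (loc v_var 0) = j"
          using st(2-4) agree_offD[OF ag2] members_agree_off[OF _ ag2] by auto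
        show "wp xs (If (Var bit_var) (Store (At sol_arr (Var u_var)) (Const 1))
              (Store (At sol_arr (Var v_var)) (Const 1)))
          (\<lambda>t2 m'. 1 + (t + (1 + (t1 + t2))) \<le> 11 + 4 * n + 2 * B \<and>
            pair_state (pair_step X (i, j) (z, S)) m') m2"
          using 1 2 st st2 assms(10) members_insert[OF st2(1)]
          by (cases "odd z") (simp_all add: step pair_state_def odd_iff_mod_2_eq_one)
      qed
      then show ?thesis using False 1 by (simp del: wp_Seq add: wp_Seq[of _ Next_Bit])
    qed
  qed
  moreover have "val xs m (Conj (Terminal (Var u_var) (Var v_var))
      (Conj (Neg (Arr sol_arr (Var u_var))) (Neg (Arr sol_arr (Var v_var))))) \<noteq> 0"
    using True assms(1,5-9) by (simp add: pair_state_def members_def)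
  ultimately show ?thesis
    unfolding Pair_Step_def by (simp only: wp_If wp_Seq if_True not_False_eq_True)
qed

text \<open>Remainders only shrink, so one bound \<open>B\<close> covers the cost of every digit
  that is split off.\<close>

lemma fold_pair_step_le: "fst (fold (pair_step X) L (z, S)) \<le> z"
proof (induction L rule: rev_induct)
  case (snoc p L)
  have "fst (pair_step X p q) \<le> fst q" for q
    by (cases p; cases q) (simp add: pair_step_def)
  with snoc show ?case using le_trans by fastforce
qed simp

lemma wp_Pairs:
  assumes "rows m" "dists (layer (n * n)) m" "members tok_arr X m" "X \<subseteq> {..<n}" "pair_state (z, {}) m" "z \<le> B"
  shows "wp xs (For u_var Order (For v_var Order Pair_Step))
    (\<lambda>t m'. t \<le> 2 + n * ((2 + n * ((11 + 4 * n + 2 * B) + 2)) + 2) \<and>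
      pair_state (fold (pair_step X) (pairs_before n 0) (z, {})) m' \<and>
      agree_off (insert u_var (insert v_var {w_var, flag_var, sol_arr, z_var, half_var, bit_var})) m m') m"
proof (rule wp_For_For[where Inv = "\<lambda>i j. pair_state (fold (pair_step X) (pairs_before i j) (z, {}))"])
  fix i j m'
  assume *: "i < n" "j < n" "pair_state (fold (pair_step X) (pairs_before i j) (z, {})) m'"
      "m' (loc u_var 0) = i" "m' (loc v_var 0) = j"
    and ag: "agree_off (insert u_var (insert v_var {w_var, flag_var, sol_arr, z_var, half_var, bit_var})) m m'"
  have "rows m'" "dists (layer (n * n)) m'" "members tok_arr X m'"
    using assms(1-3) rows_agree_off[OF _ ag] dists_agree_off[OF _ ag] members_agree_off[OF _ ag] by auto
  moreover obtain z1 S where 1: "fold (pair_step X) (pairs_before i j) (z, {}) = (z1, S)" by fastforce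
  moreover have "z1 \<le> B" using fold_pair_step_le[of X "pairs_before i j" z "{}"] assms(6) 1 by simp
  ultimately have "wp xs Pair_Step (\<lambda>t m'. t \<le> 11 + 4 * n + 2 * B \<and>
      pair_state (pair_step X (i, j) (z1, S)) m') m'"
    using * assms(4) by (intro wp_Pair_Step[where X = X]) auto
  then show "wp xs Pair_Step (\<lambda>t m'. t \<le> 11 + 4 * n + 2 * B \<and>
      pair_state (fold (pair_step X) (pairs_before i (Suc j)) (z, {})) m') m'"
    by (simp add: pairs_before_Suc 1)
qed (use assms in \<open>auto simp: pair_state_def pairs_before_row\<close>)

lemma wp_Cost:
  assumes "classes m" "members tok_arr X m" "X \<subseteq> {..<n}" "members sol_arr S m" "S \<subseteq> {..<n}"
    and "m (loc cost_var 0) = 0"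
  shows "wp xs (For v_var Order Cost_Step) (\<lambda>t m'. t \<le> 2 + n * ((4 + 4 * n) + 2) \<and>
    m' (loc cost_var 0) = cost X S \<and> agree_off (insert v_var {u_var, flag_var, cost_var}) m m') m"
proof -
  \<comment> \<open>The contribution of \<open>v\<close> to the cost: once as a chosen endpoint, and
    once as the representative of a guessed type that \<open>S\<close> misses.\<close>
  define c where "c v = (of_bool (v \<in> S) + of_bool (v \<in> X \<and> v \<notin> cls ` S) :: nat)" for v
  have "wp xs (For v_var Order Cost_Step) (\<lambda>t m'. t \<le> 2 + n * ((4 + 4 * n) + 2) \<and>
    m' (loc cost_var 0) = (\<Sum>v<n. c v) \<and> agree_off (insert v_var {u_var, flag_var, cost_var}) m m') m"
  proof (rule wp_For[where Inv = "\<lambda>i m'. m' (loc cost_var 0) = (\<Sum>v<i. c v)"])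
    fix i m1
    assume 1: "i < n" "m1 (loc cost_var 0) = (\<Sum>v<i. c v)" "m1 (loc v_var 0) = i"
      and ag1: "agree_off (insert v_var {u_var, flag_var, cost_var}) m m1"
    have st: "classes m1" "members tok_arr X m1" "members sol_arr S m1"
      using assms(1,2,4) classes_agree_off[OF _ ag1] members_agree_off[OF _ ag1] by auto
    have "wp xs (Exists flag_var u_var Order
          (Conj (Arr sol_arr (Var u_var)) (Same (Arr cls_arr (Var u_var)) (Var v_var))))
      (\<lambda>t m'. t \<le> 3 + 4 * n \<and> m' (loc flag_var 0) = of_bool (\<exists>u<n. u \<in> S \<and> cls u = i) \<and>
        agree_off {u_var, flag_var} m1 m') m1"
    proof (rule wp_Exists)
      fix m' u assume ag: "agree_off {u_var, flag_var} m1 m'" and u: "m' (loc u_var 0) = u" "u < n"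
      show "val xs m' (Conj (Arr sol_arr (Var u_var)) (Same (Arr cls_arr (Var u_var)) (Var v_var))) \<noteq> 0
          \<longleftrightarrow> u \<in> S \<and> cls u = i"
        using u 1 st agree_offD[OF ag] by (simp add: members_def classes_def)
    qed auto
    then show "wp xs Cost_Step (\<lambda>t m''. t \<le> 4 + 4 * n \<and>
        (m''(loc v_var 0 := Suc i)) (loc cost_var 0) = (\<Sum>v<Suc i. c v)) m1"
      unfolding Cost_Step_def wp_Seq
    proof (rule wp_mono)
      fix t m2 assume 2: "t \<le> 3 + 4 * n \<and> m2 (loc flag_var 0) = of_bool (\<exists>u<n. u \<in> S \<and> cls u = i) \<and>
        agree_off {u_var, flag_var} m1 m2"
      then have ag: "agree_off {u_var, flag_var} m1 m2" by simp
      have "(\<exists>u<n. u \<in> S \<and> cls u = i) \<longleftrightarrow> i \<in> cls ` S" using assms(5) by auto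
      with 1 2 st show "wp xs (Assign cost_var (Add (Var cost_var)
        (Add (Arr sol_arr (Var v_var)) (Conj (Arr tok_arr (Var v_var)) (Neg (Var flag_var))))))
        (\<lambda>t' m''. t + t' \<le> 4 + 4 * n \<and>
          (m''(loc v_var 0 := Suc i)) (loc cost_var 0) = (\<Sum>v<Suc i. c v)) m2"
        using agree_offD[OF ag] by (simp add: c_def members_def)
    qed
  qed (use assms in auto)
  moreover have "(\<Sum>v<n. c v) = cost X S"
  proof -
    have "{..<n} \<inter> S = S" "{..<n} \<inter> {v. v \<in> X \<and> v \<notin> cls ` S} = {r \<in> X. r \<notin> cls ` S}"
      using assms(3,5) by auto
    then show ?thesis
      by (simp add: c_def cost_def sum.distrib sum_of_bool_eq)
  qed
  ultimately show ?thesis by simp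
qed

section \<open>A complete run on one guess\<close>

definition accepts :: "nat \<Rightarrow> bool" where
  "accepts z \<longleftrightarrow>
     (let (z1, X) = fold token_step [0..<n] (z, {});
          (z2, S) = fold (pair_step X) (pairs_before n 0) (z1, {})
      in cost X S \<le> k)"

definition try_time :: "nat \<Rightarrow> nat" where
  "try_time B = 5 + (2 + n * ((8 + 2 * B) + 2)) + (2 + n * ((2 + n * ((11 + 4 * n + 2 * B) + 2)) + 2)) +
     (2 + n * ((4 + 4 * n) + 2))"

definition try_cells :: "nat set" where
  "try_cells = {0, tok_arr, sol_arr, u_var, v_var, w_var, flag_var, z_var, half_var, bit_var, cost_var}"

lemma wp_Try:
  assumes "rows m" "dists (layer (n * n)) m" "classes m" "m (loc guess_var 0) = z" "z \<le> B"
  shows "wp xs Try (\<lambda>t m'. t \<le> try_time B \<and>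
    m' (loc 0 0) = (if accepts z then 1 else m (loc 0 0))) m"
proof -
  obtain z1 X where X: "fold token_step [0..<n] (z, {}) = (z1, X)" by fastforce
  obtain z2 S where S: "fold (pair_step X) (pairs_before n 0) (z1, {}) = (z2, S)" by fastforce
  have acc: "accepts z \<longleftrightarrow> cost X S \<le> k" by (simp add: accepts_def X S)
  have sub: "X \<subseteq> {..<n}" "z1 \<le> z" using fold_token_step[OF X] by auto
  have "S \<subseteq> {..<n}" using fold_pair_step[OF S] by (simp add: set_pairs_before)
  define m0 where "m0 = m(loc z_var 0 := z)"
  have ag0: "agree_off try_cells m m0"
    unfolding m0_def by (rule agree_off_upd) (auto simp: try_cells_def)
  have trans: "agree_off try_cells m m''" if "agree_off try_cells m m'" "agree_off W m' m''" "W \<subseteq> try_cells"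
    for W m' m''
    using that agree_off_mono agree_off_trans by blast
  \<comment> \<open>The tables computed in advance survive every guess.\<close>
  have keep: "rows m' \<and> dists (layer (n * n)) m' \<and> classes m'" if "agree_off try_cells m m'" for m'
    using assms(1-3) rows_agree_off[OF _ that] dists_agree_off[OF _ that] classes_agree_off[OF _ that]
    by (simp add: try_cells_def)
  have "wp xs (For v_var Order Token_Step) (\<lambda>t1. wp xs (For u_var Order (For v_var Order Pair_Step))
    (\<lambda>t2. wp xs (Assign cost_var (Const 0)) (\<lambda>t3. wp xs (For v_var Order Cost_Step)
      (\<lambda>t4. wp xs (If (Sub (Var cost_var) Bound) Skip (Assign 0 (Const 1)))
        (\<lambda>t5 m'. 1 + (t1 + (t2 + (t3 + (t4 + t5)))) \<le> try_time B \<and>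
          m' (loc 0 0) = (if accepts z then 1 else m (loc 0 0))))))) m0"
  proof (rule wp_mono[OF wp_Tokens[of m0 z]])
    show "classes m0" using keep[OF ag0] by simp
    show "m0 (loc z_var 0) = z" by (simp add: m0_def)
  next
    fix t1 m1
    assume 1: "t1 \<le> 2 + n * ((8 + 2 * z) + 2) \<and> token_state n (fold token_step [0..<n] (z, {})) m1 \<and>
      agree_off (insert v_var {sol_arr, tok_arr, z_var, half_var, bit_var}) m0 m1"
    then have ag1: "agree_off try_cells m m1"
      by (elim conjE trans[OF ag0]) (auto simp: try_cells_def)
    have st1: "members tok_arr X m1" "pair_state (z1, {}) m1"
      using 1 by (auto simp: X token_state_def members_def pair_state_def)
    have "2 + n * ((8 + 2 * z) + 2) \<le> 2 + n * ((8 + 2 * B) + 2)"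
      using assms(5) by (intro add_mono mult_le_mono) auto
    with 1 have t1: "t1 \<le> 2 + n * ((8 + 2 * B) + 2)" by linarith
    show "wp xs (For u_var Order (For v_var Order Pair_Step))
      (\<lambda>t2. wp xs (Assign cost_var (Const 0)) (\<lambda>t3. wp xs (For v_var Order Cost_Step)
        (\<lambda>t4. wp xs (If (Sub (Var cost_var) Bound) Skip (Assign 0 (Const 1)))
          (\<lambda>t5 m'. 1 + (t1 + (t2 + (t3 + (t4 + t5)))) \<le> try_time B \<and>
            m' (loc 0 0) = (if accepts z then 1 else m (loc 0 0)))))) m1"
    proof (rule wp_mono[OF wp_Pairs[of m1 X z1 B]])
      show "z1 \<le> B" using sub(2) assms(5) by simp
    next
      fix t2 m2
      assume 2: "t2 \<le> 2 + n * ((2 + n * ((11 + 4 * n + 2 * B) + 2)) + 2) \<and>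
        pair_state (fold (pair_step X) (pairs_before n 0) (z1, {})) m2 \<and>
        agree_off (insert u_var (insert v_var {w_var, flag_var, sol_arr, z_var, half_var, bit_var})) m1 m2"
      then have ag: "agree_off (insert u_var (insert v_var {w_var, flag_var, sol_arr, z_var, half_var, bit_var})) m1 m2"
        by simp
      define m3 where "m3 = m2(loc cost_var 0 := 0)"
      have "agree_off try_cells m m2" by (rule trans[OF ag1 ag]) (auto simp: try_cells_def)
      then have ag3: "agree_off try_cells m m3"
        unfolding m3_def by (intro agree_off_upd) (auto simp: try_cells_def)
      have st3: "members tok_arr X m3" "members sol_arr S m3"
        using 2 members_agree_off[OF st1(1) ag] by (auto simp: S pair_state_def m3_def)
      have "wp xs (For v_var Order Cost_Step)
        (\<lambda>t4. wp xs (If (Sub (Var cost_var) Bound) Skip (Assign 0 (Const 1)))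
          (\<lambda>t5 m'. 1 + (t1 + (t2 + (1 + (t4 + t5)))) \<le> try_time B \<and>
            m' (loc 0 0) = (if accepts z then 1 else m (loc 0 0)))) m3"
      proof (rule wp_mono[OF wp_Cost[of m3 X S]])
        fix t4 m4
        assume 4: "t4 \<le> 2 + n * ((4 + 4 * n) + 2) \<and> m4 (loc cost_var 0) = cost X S \<and>
          agree_off (insert v_var {u_var, flag_var, cost_var}) m3 m4"
        then have "agree_off (insert v_var {u_var, flag_var, cost_var}) m3 m4" by simp
        note out4 = agree_offD[OF this, of 0 0]
        have "m3 (loc 0 0) = m (loc 0 0)"
          using 1 2 agree_offD[of "insert v_var {sol_arr, tok_arr, z_var, half_var, bit_var}" m0 m1 0 0]
            agree_offD[OF ag, of 0 0] by (simp add: m3_def m0_def)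
        with out4 have "m4 (loc 0 0) = m (loc 0 0)" by simp
        moreover have "1 + (t1 + (t2 + (1 + (t4 + 2)))) \<le> try_time B"
          using t1 2 4 unfolding try_time_def by linarith
        ultimately show "wp xs (If (Sub (Var cost_var) Bound) Skip (Assign 0 (Const 1)))
          (\<lambda>t5 m'. 1 + (t1 + (t2 + (1 + (t4 + t5)))) \<le> try_time B \<and>
            m' (loc 0 0) = (if accepts z then 1 else m (loc 0 0))) m4"
          using 4 acc by auto
      qed (use keep[OF ag3] st3 sub \<open>S \<subseteq> {..<n}\<close> in \<open>auto simp: m3_def\<close>)
      then show "wp xs (Assign cost_var (Const 0)) (\<lambda>t3. wp xs (For v_var Order Cost_Step)
        (\<lambda>t4. wp xs (If (Sub (Var cost_var) Bound) Skip (Assign 0 (Const 1)))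
          (\<lambda>t5 m'. 1 + (t1 + (t2 + (t3 + (t4 + t5)))) \<le> try_time B \<and>
            m' (loc 0 0) = (if accepts z then 1 else m (loc 0 0))))) m2"
        by (simp only: wp_Store val_At val.simps m3_def)
    qed (use keep[OF ag1] st1 sub in auto)
  qed
  then show ?thesis
    unfolding Try_def by (simp only: wp_Seq_fun wp_Store val_At val.simps m0_def assms(4))
qed

end

section \<open>Running time and encoding\<close>

context tms_machine
begin

text \<open>Soundness holds for every accepted number; the range comes from
  \<open>guess_complete\<close>.\<close>

lemma ex_accepts_iff: "(\<exists>z<2 ^ (card reps + k). accepts z) \<longleftrightarrow> (\<exists>Y. solution Y)"
proof
  assume "\<exists>z<2 ^ (card reps + k). accepts z"
  then obtain z where z: "accepts z" by blast
  obtain z1 X where X: "fold token_step [0..<n] (z, {}) = (z1, X)" by fastforce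
  obtain z2 S where S: "fold (pair_step X) (pairs_before n 0) (z1, {}) = (z2, S)" by fastforce
  from z have "cost X S \<le> k" by (simp add: accepts_def X S)
  with guess_sound[OF X S] show "\<exists>Y. solution Y" by blast
next
  assume "\<exists>Y. solution Y"
  then obtain Y where "solution Y" by blast
  then obtain z z1 z2 X S where "z < 2 ^ (card reps + k)"
    "fold token_step [0..<n] (z, {}) = (z1, X)"
    "fold (pair_step X) (pairs_before n 0) (z1, {}) = (z2, S)" "cost X S \<le> k"
    by (rule guess_complete)
  then show "\<exists>z<2 ^ (card reps + k). accepts z"
    by (auto simp: accepts_def intro!: exI[of _ z])
qed

lemma wp_Guesses:
  assumes "rows m" "dists (layer (n * n)) m" "classes m" "m (loc range_var 0) = Z" "m (loc 0 0) = 0"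
  shows "wp xs (For guess_var (Var range_var) Try)
    (\<lambda>t m'. t \<le> 2 + Z * (try_time Z + 2) \<and> m' (loc 0 0) = of_bool (\<exists>z<Z. accepts z)) m"
proof -
  have "wp xs (For guess_var (Var range_var) Try)
    (\<lambda>t m'. t \<le> 2 + Z * (try_time Z + 2) \<and> m' (loc 0 0) = of_bool (\<exists>z<Z. accepts z) \<and>
      agree_off (insert guess_var try_cells) m m') m"
  proof (rule wp_For[where Inv = "\<lambda>i m'. m' (loc 0 0) = of_bool (\<exists>z<i. accepts z)"])
    show "writes try_cells Try" by (auto simp: Try_def try_cells_def)
  next
    fix m' assume ag: "agree_off (insert guess_var try_cells) m m'"
    show "val xs m' (Var range_var) = Z"
      using assms(4) agree_offD[OF ag] by (simp add: try_cells_def)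
  next
    fix i m' assume *: "i < Z" "m' (loc 0 0) = of_bool (\<exists>z<i. accepts z)" "m' (loc guess_var 0) = i"
      and ag: "agree_off (insert guess_var try_cells) m m'"
    have "rows m'" "dists (layer (n * n)) m'" "classes m'"
      using assms(1-3) rows_agree_off[OF _ ag] dists_agree_off[OF _ ag] classes_agree_off[OF _ ag]
      by (auto simp: try_cells_def)
    from wp_Try[OF this *(3) less_imp_le[OF *(1)]]
    show "wp xs Try (\<lambda>t m''. t \<le> try_time Z \<and>
        (m''(loc guess_var 0 := Suc i)) (loc 0 0) = of_bool (\<exists>z<Suc i. accepts z)) m'"
      by (rule wp_mono) (use * in \<open>auto simp: less_Suc_eq\<close>)
  qed (use assms in \<open>auto simp: try_cells_def\<close>)
  then show ?thesis by (rule wp_mono) simp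
qed

section \<open>The complete program\<close>

definition total_time :: nat where
  "total_time = (2 + n * 3) +
    (((2 + n * 3) + (2 + n * n * ((2 + n * ((2 + n * ((5 + 4 * n) + 2)) + 2)) + 2))) +
    ((2 + n * ((2 + n * ((5 + 4 * n) + 2)) + 2)) +
    ((7 + 4 * n + 3 * (card reps + k)) +
     (2 + 2 ^ (card reps + k) * (try_time (2 ^ (card reps + k)) + 2)))))"

lemma wp_TMS:
  "wp xs TMS (\<lambda>t m'. t \<le> total_time \<and> m' (loc 0 0) = of_bool (\<exists>Y. solution Y)) (\<lambda>_. 0)"
  unfolding TMS_def wp_Seq_fun
proof (rule wp_mono[OF wp_Rows], goal_cases)
  case (2 t1 m1)
  then have ag1: "agree_off {u_var, row_arr} (\<lambda>_. 0) m1" by simp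
  show ?case
  proof (rule wp_mono[OF wp_Distances], goal_cases)
    case 1
    show ?case using 2 by simp
  next
    case 2
    show ?case using agree_offD[OF ag1] by (simp add: dists_def)
  next
    case (3 t2 m2)
    then have ag2: "agree_off {s_var, u_var, v_var, w_var, flag_var, dist_arr} m1 m2" by simp
    have rows2: "rows m2" using 2 rows_agree_off[OF _ ag2] by simp
    show ?case
    proof (rule wp_mono[OF wp_Classes], goal_cases)
      case 1
      show ?case by (rule rows2)
    next
      case (2 v)
      show ?case using agree_offD[OF ag2] agree_offD[OF ag1] by simp
    next
      case (3 t3 m3)
      then have ag3: "agree_off {v_var, u_var, w_var, flag_var, cls_arr} m2 m3" by simp
      have st3: "rows m3" "dists (layer (n * n)) m3"
        using rows2 \<open>_ \<and> dists (layer (n * n)) m2 \<and> _\<close> rows_agree_off[OF _ ag3] dists_agree_off[OF _ ag3]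
        by auto
      show ?case
      proof (rule wp_mono[OF wp_Guess_Range], goal_cases)
        case 1
        show ?case using 3 by simp
      next
        case 2
        show ?case using agree_offD[OF ag3] agree_offD[OF ag2] agree_offD[OF ag1] by simp
      next
        case (3 t4 m4)
        then have ag4: "agree_off {v_var, reps_var, range_var, u_var} m3 m4" by simp
        have st4: "rows m4" "dists (layer (n * n)) m4" "classes m4" "m4 (loc 0 0) = 0"
          using st3 \<open>_ \<and> classes m3 \<and> _\<close> rows_agree_off[OF _ ag4] dists_agree_off[OF _ ag4]
            classes_agree_off[OF _ ag4] agree_offD[OF ag4] agree_offD[OF ag3] agree_offD[OF ag2]
            agree_offD[OF ag1] by auto
        have times: "t1 \<le> 2 + n * 3"
          "t2 \<le> (2 + n * 3) + (2 + n * n * ((2 + n * ((2 + n * ((5 + 4 * n) + 2)) + 2)) + 2))"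
          "t3 \<le> 2 + n * ((2 + n * ((5 + 4 * n) + 2)) + 2)"
          using \<open>t1 \<le> _ \<and> _\<close> \<open>t2 \<le> _ \<and> _\<close> \<open>t3 \<le> _ \<and> _\<close> by auto
        show ?case
        proof (rule wp_mono[OF wp_Guesses[where Z = "2 ^ (card reps + k)", OF st4(1-3) _ st4(4)]], goal_cases)
          case 1
          show ?case using 3 by blast
        next
          case (2 t5 m5)
          then show ?case
            using times 3 unfolding total_time_def ex_accepts_iff by (auto intro!: add_mono)
        qed
      qed
    qed
  qed
qed simp

section \<open>A closed bound on the running time\<close>

lemma scale_bound:
  fixes x :: nat
  assumes "x \<le> a * D" "1 \<le> D"
  shows "c + x \<le> (c + a) * D"
proof -
  have "c \<le> c * D" using assms(2) by simp
  with assms(1) show ?thesis unfolding add_mult_distrib by (rule add_mono[rotated])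
qed

text \<open>Bounds are kept in the form coefficient times monomial. A loop around a body adds its
  constant to the coefficient and one factor to the monomial.\<close>

lemma loop_bound:
  fixes x :: nat
  assumes "x \<le> a * D" "1 \<le> D" "N \<le> b" "1 \<le> b"
  shows "c + N * x \<le> (c + a) * (b * D)"
proof (rule scale_bound)
  have "N * x \<le> b * (a * D)" using assms by (intro mult_le_mono) auto
  then show "N * x \<le> a * (b * D)" by (simp add: ac_simps)
  show "1 \<le> b * D" using assms(2,4) by (metis mult_le_mono nat_mult_1)
qed

lemma total_time_le:
  assumes "card reps + k \<le> p" "n \<le> b" "1 \<le> b"
  shows "total_time \<le> 1024 * (4 ^ p * b ^ 5)"
proof -
  define P :: nat where "P = 2 ^ (card reps + k)"
  have P: "1 \<le> P" "card reps + k \<le> P" by (simp_all add: P_def less_imp_le)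
  note loop = loop_bound[OF _ _ assms(2,3)]
  have le_b: "x \<le> b * x" and le_P: "x \<le> P * x" for x using assms(3) P(1) by simp_all
  have D: "1 \<le> b * b" "1 \<le> b * (b * b)" "1 \<le> b * (b * (b * b))" "1 \<le> b * P" "1 \<le> b * (b * P)"
    "1 \<le> b * (b * (b * P))"
    using assms(3) P(1) by (simp_all add: Suc_le_eq)
  \<comment> \<open>A monomial that dominates all terms. The five factors \<open>b\<close> are due
    to the distances (\<open>n * n\<close> rounds, \<open>n * n\<close> cells, \<open>n\<close>
    candidates in each search), the two factors \<open>P\<close> to the number of guesses and the
    cost of their digits.\<close>
  define W where "W = P * (b * (b * (b * (b * (b * P)))))"
  have b5: "b * (b * (b * (b * b))) \<le> W"
  proof -
    have "b * (b * (b * (b * b))) \<le> b * (b * (b * (b * (b * P))))"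
      by (intro mult_le_mono2) (use P(1) in simp)
    then show ?thesis unfolding W_def using le_P by (rule le_trans)
  qed
  have b3: "b * (b * b) \<le> W" using le_b le_b b5 by (blast intro: le_trans)
  have b2: "b * b \<le> W" using le_b b3 by (rule le_trans)
  have b1: "b \<le> W" using le_b b2 by (rule le_trans)
  have b3PP: "P * (b * (b * (b * P))) \<le> W"
    unfolding W_def by (intro mult_le_mono2 le_trans[OF le_b le_b])
  have PW: "P \<le> W"
    using le_trans[OF le_b le_trans[OF le_b le_trans[OF le_b le_trans[OF le_P b3PP]]]] .
  have d1: "(5 + 4 * n) + 2 \<le> 11 * b" using assms by simp
  have d2: "(2 + n * ((5 + 4 * n) + 2)) + 2 \<le> 15 * (b * b)"
    using loop[OF d1 assms(3), of 4] by simp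
  have d3: "(2 + n * ((2 + n * ((5 + 4 * n) + 2)) + 2)) + 2 \<le> 19 * (b * (b * b))"
    using loop[OF d2 D(1), of 4] by simp
  have "0 + n * ((2 + n * ((2 + n * ((5 + 4 * n) + 2)) + 2)) + 2) \<le> (0 + 19) * (b * (b * (b * b)))"
    by (rule loop[OF d3 D(2)])
  then have d4: "n * ((2 + n * ((2 + n * ((5 + 4 * n) + 2)) + 2)) + 2) \<le> 19 * (b * (b * (b * b)))"
    by simp
  have d5: "2 + n * n * ((2 + n * ((2 + n * ((5 + 4 * n) + 2)) + 2)) + 2) \<le> 21 * (b * (b * (b * (b * b))))"
    using loop[OF d4 D(3), of 2] by (simp only: mult.assoc) simp
  have e1: "(8 + 2 * P) + 2 \<le> 12 * P" using P(1) by simp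
  have e2: "2 + n * ((8 + 2 * P) + 2) \<le> 14 * (b * P)"
    using loop[OF e1 P(1), of 2] by simp
  have "b \<le> b * P" "P \<le> b * P" using assms(3) P(1) by simp_all
  then have f1: "(11 + 4 * n + 2 * P) + 2 \<le> 19 * (b * P)" using assms(2) D(4) by linarith
  have f2: "(2 + n * ((11 + 4 * n + 2 * P) + 2)) + 2 \<le> 23 * (b * (b * P))"
    using loop[OF f1 D(4), of 4] by simp
  have f3: "2 + n * ((2 + n * ((11 + 4 * n + 2 * P) + 2)) + 2) \<le> 25 * (b * (b * (b * P)))"
    using loop[OF f2 D(5), of 2] by simp
  have g1: "(4 + 4 * n) + 2 \<le> 10 * b" using assms by simp
  have g2: "2 + n * ((4 + 4 * n) + 2) \<le> 12 * (b * b)"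
    using loop[OF g1 assms(3), of 2] by simp
  have "b * P \<le> b * (b * (b * P))" using le_b le_b by (rule le_trans)
  moreover have "b * b \<le> b * (b * (b * P))"
    by (intro mult_le_mono2) (use le_b[of P] le_b[of "b * P"] \<open>b \<le> b * P\<close> in linarith)
  ultimately have h1: "try_time P + 2 \<le> 58 * (b * (b * (b * P)))"
    using e2 f3 g2 D(6) unfolding try_time_def by linarith
  have h2: "2 + P * (try_time P + 2) \<le> 60 * (P * (b * (b * (b * P))))"
    using loop_bound[OF h1 D(6) order.refl P(1), of 2] by simp
  have d6: "2 + n * ((2 + n * ((5 + 4 * n) + 2)) + 2) \<le> 19 * (b * (b * b))"
    using d3 by linarith
  have "1 \<le> W" "n \<le> W" "card reps + k \<le> W" using b1 PW assms(2,3) P by linarith+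
  then have "2 + n * 3 \<le> 5 * W" "7 + 4 * n + 3 * (card reps + k) \<le> 14 * W"
    using \<open>1 \<le> W\<close> by (simp_all add: algebra_simps)
  then have "total_time \<le> 5 * W + ((5 * W + 21 * W) + (19 * W + (14 * W + 60 * W)))"
    unfolding total_time_def P_def[symmetric]
    by (intro add_mono le_trans[OF d5 mult_le_mono2[OF b5]] le_trans[OF d6 mult_le_mono2[OF b3]]
        le_trans[OF h2 mult_le_mono2[OF b3PP]])
  \<comment> \<open>The coefficients sum to 124; they are rounded up to a power of 2 with room to
    spare.\<close>
  then have "total_time \<le> 1024 * W" by linarith
  also have "W = P * P * b ^ 5" by (simp add: W_def eval_nat_numeral ac_simps)
  also have "P * P = 4 ^ (card reps + k)" by (simp add: P_def flip: power_mult_distrib)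
  also have "1024 * (4 ^ (card reps + k) * b ^ 5) \<le> 1024 * (4 ^ p * b ^ 5)"
    using assms(1) by (simp add: power_increasing)
  finally show ?thesis .
qed

end

section \<open>Reading the encoded matrices\<close>

lemma length_rows: "length (concat (map (\<lambda>u. map (M u) [0..<n]) [0..<i])) = i * n"
  by (induction i) auto

lemma nth_rows:
  assumes "u < i" "v < n"
  shows "concat (map (\<lambda>u. map (M u) [0..<n]) [0..<i]) ! (u * n + v) = M u v"
  using assms(1)
proof (induction i)
  case (Suc i)
  show ?case
  proof (cases "u = i")
    case True
    then show ?thesis using assms(2) by (simp add: nth_append length_rows)
  next
    case False
    then have "u < i" using Suc.prems by simp
    have "u * n + v < Suc u * n" using assms(2) by simp
    also have "\<dots> \<le> i * n" using \<open>u < i\<close> by (intro mult_le_mono1) simp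
    finally show ?thesis using Suc.IH[OF \<open>u < i\<close>] by (simp add: nth_append length_rows)
  qed
qed simp

lemma length_bool_matrix: "length (bool_matrix n M) = n * n"
  unfolding bool_matrix_def by (rule length_rows)

lemma nth_bool_matrix: "u < n \<Longrightarrow> v < n \<Longrightarrow> bool_matrix n M ! (u * n + v) = of_bool (M u v)"
  unfolding bool_matrix_def by (rule nth_rows)

lemma tms_machine_encode:
  assumes "tms_wf I" "pverts (tms_graph I) = {..<n}"
  shows "tms_machine (tms_graph I) (tms_pairs I) (tms_bound I) n (tms_encode I)"
proof -
  interpret pair_graph "tms_graph I" using assms(1) by (simp add: tms_wf_def)
  have card: "card (pverts (tms_graph I)) = n" using assms(2) by simp
  show ?thesis
  proof
    fix u v assume uv: "{u, v} \<in> tms_pairs I"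
    then show "gdist (tms_graph I) u v < \<infinity>" using assms(1) by (simp add: tms_wf_def)
    from uv obtain u' v' where "u' < n" "v' < n" "{u, v} = {u', v'}"
      using assms unfolding tms_wf_def by (metis lessThan_iff)
    then show "u < n \<and> v < n" by (auto simp: doubleton_eq_iff)
  next
    fix u v assume "u < n" "v < n"
    then have less: "u * n + v < n * n" by (rule cell_index_less)
    show "tms_encode I ! (2 + (u * n + v)) = of_bool ((u, v) \<in> parcs (tms_graph I))"
      using less \<open>u < n\<close> \<open>v < n\<close>
      by (simp add: tms_encode_def card nth_append length_bool_matrix nth_bool_matrix)
    show "tms_encode I ! (2 + (n * n + (u * n + v))) = of_bool ({u, v} \<in> tms_pairs I)"
      using \<open>u < n\<close> \<open>v < n\<close>
      by (simp add: tms_encode_def card nth_append length_bool_matrix nth_bool_matrix)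
  qed (use assms(2) in \<open>simp_all add: tms_encode_def card length_bool_matrix\<close>)
qed

lemma bit_size_ge_length: "length xs \<le> bit_size xs"
  unfolding bit_size_def by (induction xs) auto

text \<open>Two nested doublings multiply by 4, and the loop rule is applied to a second, very small
  program.\<close>

lemma computable_power4: "computable (\<lambda>p. 4 ^ p)"
  unfolding computable_def
proof (rule exI[of _ "Seq (Assign 0 (Const 1)) (For u_var (Input (Const 0))
    (Assign 0 (Add (Add (Var 0) (Var 0)) (Add (Var 0) (Var 0)))))"], rule allI)
  fix p :: nat
  define c where "c = For u_var (Input (Const 0))
    (Assign 0 (Add (Add (Var 0) (Var 0)) (Add (Var 0) (Var 0))))"
  have "wp [p] c (\<lambda>t m'. t \<le> 2 + p * (1 + 2) \<and> m' (loc 0 0) = 4 ^ p \<and> agree_off (insert u_var {0}) ((\<lambda>_. 0)(loc 0 0 := 1)) m')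
    ((\<lambda>_. 0)(loc 0 0 := 1))"
    unfolding c_def by (rule wp_For[where Inv = "\<lambda>i m'. m' (loc 0 0) = 4 ^ i"]) auto
  then have "wp [p] (Seq (Assign 0 (Const 1)) c) (\<lambda>t m'. m' (loc 0 0) = 4 ^ p) (\<lambda>_. 0)"
    by (simp only: wp_Seq wp_Store val_At val.simps) (erule wp_mono, simp)
  then show "\<exists>t. halts_with (Seq (Assign 0 (Const 1)) (For u_var (Input (Const 0))
    (Assign 0 (Add (Add (Var 0) (Var 0)) (Add (Var 0) (Var 0)))))) [p] t (4 ^ p)"
    by (auto simp: wp_def halts_with_def c_def loc_def)
qed

theorem theorem3:
  shows "fpt tms_instances {I. tms_yes I} tms_encode tms_parameter"
  unfolding fpt_def
proof (rule exI[of _ TMS], rule exI[of _ "\<lambda>p. 4 ^ p"], rule exI[of _ 15], intro conjI ballI)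
  show "computable (\<lambda>p. 4 ^ p)" by (rule computable_power4)
next
  fix I :: "nat tms" assume "I \<in> tms_instances"
  then obtain n where wf: "tms_wf I" and n: "pverts (tms_graph I) = {..<n}"
    by (auto simp: tms_instances_def)
  interpret tms_machine "tms_graph I" "tms_pairs I" "tms_bound I" n "tms_encode I"
    using wf n by (rule tms_machine_encode)
  have yes: "(\<exists>Y. solution Y) \<longleftrightarrow> I \<in> {I. tms_yes I}"
    by (auto simp: solution_def tms_yes_def monitors_def verts)
  obtain t m where run: "exec (tms_encode I) TMS (\<lambda>_. 0) t m" "t \<le> total_time"
    "m (loc 0 0) = of_bool (\<exists>Y. solution Y)"
    using wp_TMS unfolding wp_def by blast
  define b where "b = bit_size (tms_encode I)"
  \<comment> \<open>The matrices make the input at least as long as \<open>n\<close>, and the two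
    leading words give \<open>2 \<le> b\<close> even for the empty graph.\<close>
  have "n \<le> n * n" by simp
  then have b: "n \<le> b" "2 \<le> b"
    using bit_size_ge_length[of "tms_encode I"] unfolding b_def input_length by linarith+
  have "card reps + tms_bound I \<le> tms_parameter I"
    using card_reps_le by (simp add: tms_parameter_def)
  then have "total_time \<le> 1024 * (4 ^ tms_parameter I * b ^ 5)"
    using b by (intro total_time_le) auto
  \<comment> \<open>The constant \<open>1024 = 2 ^ 10\<close> is absorbed by \<open>b ^ 10\<close>,
    whence the exponent \<open>15 = 10 + 5\<close> and a parameter function without a constant
    factor.\<close>
  also have "\<dots> \<le> b ^ 10 * (4 ^ tms_parameter I * b ^ 5)"
    using power_mono[OF b(2), of 10] by (intro mult_le_mono1) simp
  also have "\<dots> = 4 ^ tms_parameter I * b ^ 15" by (simp flip: power_add)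
  finally have "t \<le> 4 ^ tms_parameter I * b ^ 15" using run(2) by simp
  moreover have "halts_with TMS (tms_encode I) t (if I \<in> {I. tms_yes I} then 1 else 0)"
    using run(1,3) unfolding halts_with_def yes by (auto simp: loc_def)
  ultimately show "\<exists>t. halts_with TMS (tms_encode I) t (if I \<in> {I. tms_yes I} then 1 else 0) \<and>
      t \<le> 4 ^ tms_parameter I * bit_size (tms_encode I) ^ 15"
    unfolding b_def by blast
qed

end
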